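(* Let $(\lambda,\kappa)\in\mathbb{R}^-\times\mathbb{R}^-$ and consider the periodic initial boundary value problem for the generalized Hunter-Saxton system (see context). For initial data $(u_0,\rho_0)$ let $C(\alpha)=\lambda(\lambda u_0'(\alpha)^2-\kappa\rho_0(\alpha)^2)$, $\Omega=\{\alpha\in[0,1]: C(\alpha)=0\}$, $\Sigma=\{\alpha\in[0,1]: C(\alpha)\neq0\}$, and denote by $\overline\alpha$ the finite number of locations in $[0,1]$ where the largest of $$M=\max_{\alpha\in\Omega,\ \rho_0(\alpha)\neq0}\{2\lambda u_0'(\alpha)\},\qquad N=\max_{\alpha\in\Sigma,\ \rho_0(\alpha)\neq0}\{\lambda u_0'(\alpha)+\sqrt{\lambda\kappa}\,|\rho_0(\alpha)|\}$$ is attained. Then there exist smooth initial data (for which the earliest zero $\eta_*$ of $\mathcal{Q}$ is a single root) and a finite $t_*>0$ such that: (1) For $(\lambda,\kappa)\in\mathbb{R}^-\times\mathbb{R}^-$, $u_x(\gamma(\overline\alpha,t),t)\to-\infty$ as $t\uparrow t_*$, whereas, if $\alpha\neq\overline\alpha$, $u_x(\gamma(\alpha,t),t)$ remains finite for $(\lambda,\kappa)\in(-1,0)\times\mathbb{R}^-$ and $0\le t\le t_*$, but diverges to $+\infty$, as $t\uparrow t_*$, when $(\lambda,\kappa)\in(-\infty,-1]\times\mathbb{R}^-$. (2) For $\rho_0(\overline\alpha)>0$ or $\rho_0(\overline\alpha)<0$, $\rho(\gamma(\overline\alpha,t),t)$ diverges, as $t\uparrow t_*$, to $+\infty$ or respectively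 $-\infty$, but $\rho(\gamma(\alpha,t),t)$ remains finite for $\alpha\ne\overline\alpha$.
   Context: The initial boundary value problem is $$u_{xt}+uu_{xx}-\lambda u_x^2-\kappa\rho^2=I(t),\qquad \rho_t+u\rho_x=2\lambda\rho u_x,\qquad t>0,$$ $$I(t)=-\kappa\int_0^1\rho^2\,dx-(1+\lambda)\int_0^1u_x^2\,dx,$$ with $u(x,0)=u_0(x)$, $\rho(x,0)=\rho_0(x)$ for $x\in[0,1]$, and periodic boundary conditions $u(0,t)=u(1,t)$, $u_x(0,t)=u_x(1,t)$, $\rho(0,t)=\rho(1,t)$; $u$ is assumed to have mean zero, $\int_0^1u\,dx\equiv0$. Characteristics: $\dot\gamma(\alpha,t)=u(\gamma(\alpha,t),t)$, $\gamma(\alpha,0)=\alpha$. The solution along characteristics is understood through the representation formulas (for $\lambda\ne0$): with $\mathcal{Q}(\alpha,t)=C(\alpha)\eta(t)^2-2\lambda u_0'(\alpha)\eta(t)+1$, $\bar{\mathcal{P}}_0(t)=\int_0^1\mathcal{Q}(\alpha,t)^{-\frac1{2\lambda}}d\alpha$, and $\eta$ the strictly increasing solution of $\dot\eta=\bar{\mathcal{P}}_0^{-2\lambda}$, $\eta(0)=0$, $$u_x(\gamma(\alpha,t),t)=\frac{\bar{\mathcal{P}}_0^{-2\lambda}}{\lambda}\left\{\frac{\lambda u_0'(\alpha)-\eta C(\alpha)}{\mathcal{Q}(\alpha,t)}-\frac{1}{\bar{\mathcal{P}}_0}\int_0^1\frac{\lambda u_0'(\alpha)-\eta C(\alpha)}{\mathcal{Q}(\alpha,t)^{1+\frac1{2\lambda}}}d\alpha\right\},\qquad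 \rho(\gamma(\alpha,t),t)=\frac{\rho_0(\alpha)}{\mathcal{Q}(\alpha,t)}\bar{\mathcal{P}}_0^{-2\lambda}.$$ $\eta_*>0$ denotes the least positive value of $\eta$ at which $\mathcal{Q}$ vanishes for some $\alpha\in[0,1]$ (the zero is attained at the points $\overline\alpha$); it is a single root when, as a polynomial in $\eta$, $\mathcal{Q}$ at $\alpha=\overline\alpha$ has $\eta_*$ as a zero of multiplicity one. Here $\eta_*$ is the reciprocal of the larger of $M$ and $N$; the maximum $N$ may fail to exist since $\Sigma$ need not be closed, and in that case only $M$ is used. The time $t_*$ is $$t_*=\lim_{\eta\uparrow\eta_*}\int_0^\eta\left(\int_0^1\frac{d\alpha}{(C(\alpha)\sigma^2-2\lambda u_0'(\alpha)\sigma+1)^{\frac1{2\lambda}}}\right)^{2\lambda}d\sigma.$$ Standing assumptions: $\rho_0\not\equiv0$, $C(\alpha)\not\equiv0$, and $\Omega$ is a non-empty finite set. "$\alpha\ne\overline\alpha$" means $\alpha$ is not one of the points $\overline\alpha$. $\mathbb{R}^-=(-\infty,0)$. *)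

theory Defs
  imports "HOL-Analysis.Analysis" "HOL-Computational_Algebra.Polynomial"
begin

text \<open>
  Spatially periodic functions are functions on the whole line with period 1, so that the boundary
  conditions at 0 and 1 hold for the function and for all its derivatives, and so that a
  characteristic may leave the unit interval.
\<close>

definition periodic1 :: "(real \<Rightarrow> real) \<Rightarrow> bool" where
  "periodic1 f \<longleftrightarrow> (\<forall>x. f (x + 1) = f x)"

definition smooth :: "(real \<Rightarrow> real) \<Rightarrow> bool" where
  "smooth f \<longleftrightarrow> (\<forall>n x. (deriv ^^ n) f differentiable at x)"

definition D_x :: "(real \<Rightarrow> real \<Rightarrow> real) \<Rightarrow> real \<Rightarrow> real \<Rightarrow> real" where
  "D_x f x t = deriv (\<lambda>y. f y t) x"

definition D_t :: "(real \<Rightarrow> real \<Rightarrow> real) \<Rightarrow> real \<Rightarrow> real \<Rightarrow> real" where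
  "D_t f x t = deriv (\<lambda>s. f x s) t"

definition C1_on_strip :: "real \<Rightarrow> (real \<Rightarrow> real \<Rightarrow> real) \<Rightarrow> bool" where
  "C1_on_strip T f \<longleftrightarrow>
     (\<forall>x. \<forall>t\<in>{0<..<T}. (\<lambda>y. f y t) differentiable at x \<and> (\<lambda>s. f x s) differentiable at t) \<and>
     continuous_on (UNIV \<times> {0<..<T}) (\<lambda>(x, t). D_x f x t) \<and>
     continuous_on (UNIV \<times> {0<..<T}) (\<lambda>(x, t). D_t f x t)"


subsection \<open>Classical solutions of the initial boundary value problem\<close>

definition nonlocal_I :: "real \<Rightarrow> real \<Rightarrow> (real \<Rightarrow> real \<Rightarrow> real) \<Rightarrow> (real \<Rightarrow> real \<Rightarrow> real) \<Rightarrow> real \<Rightarrow> real" where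
  "nonlocal_I lam \<kappa> u \<rho> t =
     - \<kappa> * integral {0..1} (\<lambda>x. (\<rho> x t)\<^sup>2) - (1 + lam) * integral {0..1} (\<lambda>x. (D_x u x t)\<^sup>2)"

text \<open>
  The system is required on the open time interval; the initial data are attained
  continuously.  The time derivative of \<open>u\<close> itself does not occur in the system.
\<close>

definition classical_solution ::
  "real \<Rightarrow> real \<Rightarrow> (real \<Rightarrow> real) \<Rightarrow> (real \<Rightarrow> real) \<Rightarrow> real
     \<Rightarrow> (real \<Rightarrow> real \<Rightarrow> real) \<Rightarrow> (real \<Rightarrow> real \<Rightarrow> real) \<Rightarrow> bool" where
  "classical_solution lam \<kappa> u0 \<rho>0 T u \<rho> \<longleftrightarrow>
     (\<forall>t\<in>{0..<T}. periodic1 (\<lambda>x. u x t) \<and> periodic1 (\<lambda>x. \<rho> x t)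
        \<and> integral {0..1} (\<lambda>x. u x t) = 0
        \<and> (\<forall>x. (\<lambda>y. u y t) differentiable at x)) \<and>
     continuous_on (UNIV \<times> {0..<T}) (\<lambda>(x, t). u x t) \<and>
     continuous_on (UNIV \<times> {0..<T}) (\<lambda>(x, t). D_x u x t) \<and>
     continuous_on (UNIV \<times> {0..<T}) (\<lambda>(x, t). \<rho> x t) \<and>
     C1_on_strip T (D_x u) \<and> C1_on_strip T \<rho> \<and>
     (\<forall>x. u x 0 = u0 x \<and> \<rho> x 0 = \<rho>0 x) \<and>
     (\<forall>x. \<forall>t\<in>{0<..<T}.
        D_t (D_x u) x t + u x t * D_x (D_x u) x t - lam * (D_x u x t)\<^sup>2 - \<kappa> * (\<rho> x t)\<^sup>2
          = nonlocal_I lam \<kappa> u \<rho> t \<and>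
        D_t \<rho> x t + u x t * D_x \<rho> x t = 2 * lam * \<rho> x t * D_x u x t)"

definition characteristics :: "real \<Rightarrow> (real \<Rightarrow> real \<Rightarrow> real) \<Rightarrow> (real \<Rightarrow> real \<Rightarrow> real) \<Rightarrow> bool" where
  "characteristics T u \<gamma> \<longleftrightarrow>
     (\<forall>\<alpha>\<in>{0..1}. \<gamma> \<alpha> 0 = \<alpha> \<and>
        (\<forall>t\<in>{0..<T}. (\<gamma> \<alpha> has_real_derivative u (\<gamma> \<alpha> t) t) (at t within {0..<T})))"


subsection \<open>Quantities determined by the initial data\<close>

definition C_fun :: "real \<Rightarrow> real \<Rightarrow> (real \<Rightarrow> real) \<Rightarrow> (real \<Rightarrow> real) \<Rightarrow> real \<Rightarrow> real" where
  "C_fun lam \<kappa> u0 \<rho>0 \<alpha> = lam * (lam * (deriv u0 \<alpha>)\<^sup>2 - \<kappa> * (\<rho>0 \<alpha>)\<^sup>2)"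

definition Omega_set :: "real \<Rightarrow> real \<Rightarrow> (real \<Rightarrow> real) \<Rightarrow> (real \<Rightarrow> real) \<Rightarrow> real set" where
  "Omega_set lam \<kappa> u0 \<rho>0 = {\<alpha>\<in>{0..1}. C_fun lam \<kappa> u0 \<rho>0 \<alpha> = 0}"

definition Sigma_set :: "real \<Rightarrow> real \<Rightarrow> (real \<Rightarrow> real) \<Rightarrow> (real \<Rightarrow> real) \<Rightarrow> real set" where
  "Sigma_set lam \<kappa> u0 \<rho>0 = {\<alpha>\<in>{0..1}. C_fun lam \<kappa> u0 \<rho>0 \<alpha> \<noteq> 0}"

definition Q_poly :: "real \<Rightarrow> real \<Rightarrow> (real \<Rightarrow> real) \<Rightarrow> (real \<Rightarrow> real) \<Rightarrow> real \<Rightarrow> real poly" where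
  "Q_poly lam \<kappa> u0 \<rho>0 \<alpha> = [:1, - 2 * lam * deriv u0 \<alpha>, C_fun lam \<kappa> u0 \<rho>0 \<alpha>:]"

text \<open>In \<open>Q\<close> and \<open>P0_bar\<close> the last argument is the value of \<open>\<eta>\<close>, not the time.\<close>

definition Q :: "real \<Rightarrow> real \<Rightarrow> (real \<Rightarrow> real) \<Rightarrow> (real \<Rightarrow> real) \<Rightarrow> real \<Rightarrow> real \<Rightarrow> real" where
  "Q lam \<kappa> u0 \<rho>0 \<alpha> \<eta> = C_fun lam \<kappa> u0 \<rho>0 \<alpha> * \<eta>\<^sup>2 - 2 * lam * deriv u0 \<alpha> * \<eta> + 1"

lemma poly_Q_poly: "poly (Q_poly lam \<kappa> u0 \<rho>0 \<alpha>) \<eta> = Q lam \<kappa> u0 \<rho>0 \<alpha> \<eta>"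
  by (simp add: Q_poly_def Q_def power2_eq_square algebra_simps)

definition P0_bar :: "real \<Rightarrow> real \<Rightarrow> (real \<Rightarrow> real) \<Rightarrow> (real \<Rightarrow> real) \<Rightarrow> real \<Rightarrow> real" where
  "P0_bar lam \<kappa> u0 \<rho>0 \<eta> = integral {0..1} (\<lambda>\<alpha>. Q lam \<kappa> u0 \<rho>0 \<alpha> \<eta> powr (- 1 / (2 * lam)))"

definition is_maximum :: "real set \<Rightarrow> real \<Rightarrow> bool" where
  "is_maximum S m \<longleftrightarrow> m \<in> S \<and> (\<forall>s\<in>S. s \<le> m)"

definition is_M :: "real \<Rightarrow> real \<Rightarrow> (real \<Rightarrow> real) \<Rightarrow> (real \<Rightarrow> real) \<Rightarrow> real \<Rightarrow> bool" where
  "is_M lam \<kappa> u0 \<rho>0 =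
     is_maximum {2 * lam * deriv u0 \<alpha> | \<alpha>. \<alpha> \<in> Omega_set lam \<kappa> u0 \<rho>0 \<and> \<rho>0 \<alpha> \<noteq> 0}"

definition is_N :: "real \<Rightarrow> real \<Rightarrow> (real \<Rightarrow> real) \<Rightarrow> (real \<Rightarrow> real) \<Rightarrow> real \<Rightarrow> bool" where
  "is_N lam \<kappa> u0 \<rho>0 =
     is_maximum {lam * deriv u0 \<alpha> + sqrt (lam * \<kappa>) * \<bar>\<rho>0 \<alpha>\<bar> | \<alpha>.
                   \<alpha> \<in> Sigma_set lam \<kappa> u0 \<rho>0 \<and> \<rho>0 \<alpha> \<noteq> 0}"

text \<open>
  The larger of those of the two maxima which exist: if one of them is not attained, only the
  other one enters.
\<close>

definition is_larger_MN :: "real \<Rightarrow> real \<Rightarrow> (real \<Rightarrow> real) \<Rightarrow> (real \<Rightarrow> real) \<Rightarrow> real \<Rightarrow> bool" where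
  "is_larger_MN lam \<kappa> u0 \<rho>0 = is_maximum {m. is_M lam \<kappa> u0 \<rho>0 m \<or> is_N lam \<kappa> u0 \<rho>0 m}"

definition alpha_bar :: "real \<Rightarrow> real \<Rightarrow> (real \<Rightarrow> real) \<Rightarrow> (real \<Rightarrow> real) \<Rightarrow> real set" where
  "alpha_bar lam \<kappa> u0 \<rho>0 = {\<alpha>. \<rho>0 \<alpha> \<noteq> 0 \<and> (\<exists>m. is_larger_MN lam \<kappa> u0 \<rho>0 m \<and>
     (\<alpha> \<in> Omega_set lam \<kappa> u0 \<rho>0 \<and> is_M lam \<kappa> u0 \<rho>0 m \<and> 2 * lam * deriv u0 \<alpha> = m \<or>
      \<alpha> \<in> Sigma_set lam \<kappa> u0 \<rho>0 \<and> is_N lam \<kappa> u0 \<rho>0 m \<and>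
        lam * deriv u0 \<alpha> + sqrt (lam * \<kappa>) * \<bar>\<rho>0 \<alpha>\<bar> = m))}"

definition is_eta_star :: "real \<Rightarrow> real \<Rightarrow> (real \<Rightarrow> real) \<Rightarrow> (real \<Rightarrow> real) \<Rightarrow> real \<Rightarrow> bool" where
  "is_eta_star lam \<kappa> u0 \<rho>0 \<eta>s \<longleftrightarrow> 0 < \<eta>s \<and>
     (\<exists>\<alpha>\<in>{0..1}. Q lam \<kappa> u0 \<rho>0 \<alpha> \<eta>s = 0) \<and>
     (\<forall>\<eta>. 0 < \<eta> \<and> \<eta> < \<eta>s \<longrightarrow> (\<forall>\<alpha>\<in>{0..1}. Q lam \<kappa> u0 \<rho>0 \<alpha> \<eta> \<noteq> 0))"

definition admissible_data :: "real \<Rightarrow> real \<Rightarrow> (real \<Rightarrow> real) \<Rightarrow> (real \<Rightarrow> real) \<Rightarrow> bool" where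
  "admissible_data lam \<kappa> u0 \<rho>0 \<longleftrightarrow>
     smooth u0 \<and> smooth \<rho>0 \<and> periodic1 u0 \<and> periodic1 \<rho>0 \<and> integral {0..1} u0 = 0 \<and>
     (\<exists>\<alpha>\<in>{0..1}. \<rho>0 \<alpha> \<noteq> 0) \<and> (\<exists>\<alpha>\<in>{0..1}. C_fun lam \<kappa> u0 \<rho>0 \<alpha> \<noteq> 0) \<and>
     Omega_set lam \<kappa> u0 \<rho>0 \<noteq> {} \<and> finite (Omega_set lam \<kappa> u0 \<rho>0)"

definition single_root_data :: "real \<Rightarrow> real \<Rightarrow> (real \<Rightarrow> real) \<Rightarrow> (real \<Rightarrow> real) \<Rightarrow> real \<Rightarrow> bool" where
  "single_root_data lam \<kappa> u0 \<rho>0 \<eta>s \<longleftrightarrow>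
     is_eta_star lam \<kappa> u0 \<rho>0 \<eta>s \<and>
     (\<exists>m. is_larger_MN lam \<kappa> u0 \<rho>0 m \<and> \<eta>s = 1 / m) \<and>
     finite (alpha_bar lam \<kappa> u0 \<rho>0) \<and>
     {\<alpha>\<in>{0..1}. Q lam \<kappa> u0 \<rho>0 \<alpha> \<eta>s = 0} = alpha_bar lam \<kappa> u0 \<rho>0 \<and>
     (\<forall>\<alpha>\<in>alpha_bar lam \<kappa> u0 \<rho>0. order \<eta>s (Q_poly lam \<kappa> u0 \<rho>0 \<alpha>) = 1)"

definition is_t_star :: "real \<Rightarrow> real \<Rightarrow> (real \<Rightarrow> real) \<Rightarrow> (real \<Rightarrow> real) \<Rightarrow> real \<Rightarrow> real \<Rightarrow> bool" where
  "is_t_star lam \<kappa> u0 \<rho>0 \<eta>s ts \<longleftrightarrow>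
     ((\<lambda>\<eta>. integral {0..\<eta>} (\<lambda>\<sigma>.
         (integral {0..1} (\<lambda>\<alpha>. 1 / (C_fun lam \<kappa> u0 \<rho>0 \<alpha> * \<sigma>\<^sup>2 - 2 * lam * deriv u0 \<alpha> * \<sigma> + 1)
                                    powr (1 / (2 * lam)))) powr (2 * lam)))
      \<longlongrightarrow> ts) (at_left \<eta>s)"


subsection \<open>Representation along characteristics\<close>

definition is_eta :: "real \<Rightarrow> real \<Rightarrow> (real \<Rightarrow> real) \<Rightarrow> (real \<Rightarrow> real) \<Rightarrow> real \<Rightarrow> (real \<Rightarrow> real) \<Rightarrow> bool" where
  "is_eta lam \<kappa> u0 \<rho>0 T \<eta> \<longleftrightarrow> \<eta> 0 = 0 \<and> strict_mono_on {0..<T} \<eta> \<and>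
     (\<forall>t\<in>{0..<T}. (\<eta> has_real_derivative P0_bar lam \<kappa> u0 \<rho>0 (\<eta> t) powr (- 2 * lam))
                     (at t within {0..<T}))"

definition ux_formula :: "real \<Rightarrow> real \<Rightarrow> (real \<Rightarrow> real) \<Rightarrow> (real \<Rightarrow> real) \<Rightarrow> real \<Rightarrow> real \<Rightarrow> real" where
  "ux_formula lam \<kappa> u0 \<rho>0 \<alpha> \<eta> =
     P0_bar lam \<kappa> u0 \<rho>0 \<eta> powr (- 2 * lam) / lam *
       ((lam * deriv u0 \<alpha> - \<eta> * C_fun lam \<kappa> u0 \<rho>0 \<alpha>) / Q lam \<kappa> u0 \<rho>0 \<alpha> \<eta>
        - 1 / P0_bar lam \<kappa> u0 \<rho>0 \<eta> *
          integral {0..1} (\<lambda>\<beta>. (lam * deriv u0 \<beta> - \<eta> * C_fun lam \<kappa> u0 \<rho>0 \<beta>)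
                                 / Q lam \<kappa> u0 \<rho>0 \<beta> \<eta> powr (1 + 1 / (2 * lam))))"

definition rho_formula :: "real \<Rightarrow> real \<Rightarrow> (real \<Rightarrow> real) \<Rightarrow> (real \<Rightarrow> real) \<Rightarrow> real \<Rightarrow> real \<Rightarrow> real" where
  "rho_formula lam \<kappa> u0 \<rho>0 \<alpha> \<eta> =
     \<rho>0 \<alpha> / Q lam \<kappa> u0 \<rho>0 \<alpha> \<eta> * P0_bar lam \<kappa> u0 \<rho>0 \<eta> powr (- 2 * lam)"

definition represented_solution ::
  "real \<Rightarrow> real \<Rightarrow> (real \<Rightarrow> real) \<Rightarrow> (real \<Rightarrow> real) \<Rightarrow> (real \<Rightarrow> real) \<Rightarrow> real
     \<Rightarrow> (real \<Rightarrow> real \<Rightarrow> real) \<Rightarrow> (real \<Rightarrow> real \<Rightarrow> real) \<Rightarrow> (real \<Rightarrow> real \<Rightarrow> real) \<Rightarrow> bool" where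
  "represented_solution lam \<kappa> u0 \<rho>0 \<eta> T u \<rho> \<gamma> \<longleftrightarrow>
     classical_solution lam \<kappa> u0 \<rho>0 T u \<rho> \<and> characteristics T u \<gamma> \<and>
     (\<forall>\<alpha>\<in>{0..1}. \<forall>t\<in>{0..<T}.
        D_x u (\<gamma> \<alpha> t) t = ux_formula lam \<kappa> u0 \<rho>0 \<alpha> (\<eta> t) \<and>
        \<rho> (\<gamma> \<alpha> t) t = rho_formula lam \<kappa> u0 \<rho>0 \<alpha> (\<eta> t))"

text \<open>
  A quantity remains finite on the closed interval from 0 to \<open>T\<close>: it is bounded before \<open>T\<close>
  and has a finite limit at \<open>T\<close>.
\<close>

definition remains_finite :: "real \<Rightarrow> (real \<Rightarrow> real) \<Rightarrow> bool" where
  "remains_finite T f \<longleftrightarrow> bounded (f ` {0..<T}) \<and> (\<exists>L. (f \<longlongrightarrow> L) (at_left T))"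

end

theory Submission
  imports Defs "HOL-Real_Asymp.Real_Asymp"
begin

text \<open>
  \<^bold>\<open>Choice of data.\<close> Take \<open>\<lambda> u\<^sub>0' = (2/3) cos (2 \<pi> \<alpha>)\<close> and the constant
  \<open>\<surd>(\<lambda>\<kappa>) \<rho>\<^sub>0 = 1/3\<close>.  Since \<open>C = (\<lambda> u\<^sub>0')\<^sup>2 - \<lambda>\<kappa> \<rho>\<^sub>0\<^sup>2\<close>, the quadratic \<open>Q\<close> splits as
  \<open>(1 - (\<lambda> u\<^sub>0' + 1/3) \<eta>) (1 - (\<lambda> u\<^sub>0' - 1/3) \<eta>)\<close>.  Its first zero is \<open>\<eta> = 1\<close>, it occurs only at
  the maxima \<open>\<alpha> = 0, 1\<close> of the cosine, and there the second factor is \<open>2/3\<close>, so the root is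
  simple (\<open>single_root_wave\<close>).

  \<^bold>\<open>Existence of the solution.\<close> The representation formulas prescribe the Jacobian
  \<open>g = Q\<^sup>p / P\<close>, \<open>p = -1/(2\<lambda>)\<close>, of the characteristic flow, where \<open>P\<close> is the mean of \<open>Q\<^sup>p\<close>.
  For odd \<open>u\<^sub>0\<close> and even \<open>\<rho>\<^sub>0\<close> the point 0 stays fixed, so the flow is \<open>G\<close>, the primitive of \<open>g\<close>
  vanishing at 0; oddness also gives \<open>u\<close> mean zero.  For each fixed \<open>\<eta>\<close> the map \<open>G\<close> is a
  diffeomorphism of the line, and its inverse \<open>H\<close> is differentiable in both variables, so \<open>u\<close>
  and \<open>\<rho>\<close> can be defined by transporting functions of the label \<open>\<alpha>\<close>.  Along characteristics the system
  becomes a pair of ordinary differential equations in \<open>\<eta>\<close>.  They hold because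
  \<open>Q\<^sub>\<eta>\<^sup>2 - 2 Q Q\<^sub>\<eta>\<^sub>\<eta> = 4 \<lambda>\<kappa> \<rho>\<^sub>0\<^sup>2\<close> does not depend on \<open>\<eta>\<close> (\<open>discriminant\<close>), which makes
  \<open>u\<^sub>x\<^sub>t + u u\<^sub>x\<^sub>x - \<lambda> u\<^sub>x\<^sup>2 - \<kappa>\<rho>\<^sup>2\<close> a function of time alone (\<open>V_equation\<close>); integrating over a period
  identifies that function with the nonlocal term (\<open>nonlocal_identity\<close>).

  \<^bold>\<open>Finite blowup time.\<close> The mean \<open>P\<close> is continuous and positive up to and including \<open>\<eta> = 1\<close>, hence
  \<open>dt/d\<eta> = P\<^bsup>2\<lambda>\<^esup>\<close> is integrable and the time \<open>ts\<close> at which \<open>\<eta>\<close> reaches 1 is finite.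

  \<^bold>\<open>Behaviour at the blowup time.\<close> Write \<open>u\<^sub>x = (E/\<lambda>) (num/Q - nonlocal/P)\<close> with \<open>E = P\<^bsup>-2\<lambda>\<^esup>\<close>
  positive and convergent; \<open>nonlocal\<close> is the mean of \<open>num/Q\<^sup>r\<close>, \<open>r = 1 + 1/(2\<lambda>) < 1\<close>.  At \<open>\<alpha> = 0, 1\<close> the local
  term grows like \<open>1/(1 - \<eta>)\<close>, whereas \<open>Q \<ge> (2/3) (1 - \<eta>)\<close> and \<open>r < 1\<close> show that
  \<open>nonlocal\<close> is of smaller order (\<open>nonlocal_negligible\<close>); as \<open>\<lambda> < 0\<close>, this forces \<open>u\<^sub>x \<rightarrow> -\<infinity>\<close>.  Elsewhere the
  local term converges and \<open>nonlocal\<close> decides.  Near the maximum of the cosine \<open>Q\<close> is comparable to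
  \<open>(1 - \<eta>) + \<alpha>\<^sup>2\<close>, so the integrals of \<open>Q\<^bsup>-r\<^esup>\<close> stay bounded exactly when \<open>2 r < 1\<close>, that is \<open>\<lambda> > -1\<close>
  (\<open>nonlocal_converges\<close>, by dominated convergence); for \<open>\<lambda> \<le> -1\<close> they diverge at least
  logarithmically (\<open>nonlocal_diverges\<close>).  Finally \<open>\<rho>\<close> is \<open>E \<rho>\<^sub>0 / Q\<close>, which blows up only where \<open>Q\<close> vanishes.
\<close>

section \<open>Primitives depending on a parameter\<close>

text \<open>
  The primitive of \<open>f\<close> vanishing at 0.  Writing \<open>\<integral>\<^sub>0\<^sup>x f\<close> over the unit interval makes sense of it for
  negative \<open>x\<close>, shows its parity at once, and keeps the domain of integration fixed when \<open>f\<close> depends on a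
  parameter.
\<close>

definition prim :: "(real \<Rightarrow> real) \<Rightarrow> real \<Rightarrow> real" where
  "prim f x = integral {0..1} (\<lambda>s. x * f (x * s))"

lemma prim_0 [simp]: "prim f 0 = 0"
  by (simp add: prim_def)

lemma prim_1: "prim f 1 = integral {0..1} f"
  by (simp add: prim_def)

lemma prim_eq_diff:
  assumes "\<And>s. s \<in> {0..1} \<Longrightarrow> (g has_real_derivative f (x * s)) (at (x * s))"
  shows "prim f x = g x - g 0"
proof -
  have "((\<lambda>s. x * f (x * s)) has_integral (g (x * 1) - g (x * 0))) {0..1}"
  proof (rule fundamental_theorem_of_calculus)
    fix s :: real assume s: "s \<in> {0..1}"
    have "((\<lambda>s. g (x * s)) has_real_derivative f (x * s) * x) (at s)"
      by (rule DERIV_chain2[where f=g and g="\<lambda>s. x * s"]) (auto intro!: derivative_eq_intros assms s)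
    then show "((\<lambda>s. g (x * s)) has_vector_derivative x * f (x * s)) (at s within {0..1})"
      by (simp add: has_real_derivative_iff_has_vector_derivative mult.commute
          has_vector_derivative_at_within)
  qed simp
  then show ?thesis by (simp only: prim_def integral_unique) simp
qed

lemma DERIV_prim:
  assumes f: "continuous_on UNIV f"
  shows "(prim f has_real_derivative f x) (at x)"
proof -
  define N where "N = \<bar>x\<bar> + 1"
  define g where "g = (\<lambda>y. integral {-N..y} f)"
  have g: "(g has_real_derivative f y) (at y)" if "y \<in> {-N<..<N}" for y
  proof -
    have "(g has_real_derivative f y) (at y within {-N..N})"
      unfolding g_def using that
      by (intro integral_has_real_derivative continuous_on_subset[OF f]) auto
    then show ?thesis using that by (simp add: at_within_Icc_at)
  qed
  have eq: "prim f z = g z - g 0" if z: "z \<in> {-N<..<N}" for z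
  proof (rule prim_eq_diff)
    fix s :: real assume s: "s \<in> {0..1}"
    have "\<bar>z * s\<bar> \<le> \<bar>z\<bar> * 1" unfolding abs_mult using s by (intro mult_left_mono) auto
    then show "(g has_real_derivative f (z * s)) (at (z * s))" using z by (intro g) auto
  qed
  have x: "x \<in> {-N<..<N}" by (auto simp: N_def)
  have "((\<lambda>z. g z - g 0) has_real_derivative f x) (at x)"
    using g[OF x] by (auto intro!: derivative_eq_intros)
  then show ?thesis
    by (rule has_field_derivative_transform_within_open[where S="{-N<..<N}"]) (use x eq in auto)
qed

lemma prim_odd:
  assumes "\<And>x. f (-x) = f x"
  shows "prim f (-x) = - prim f x"
  using assms by (simp add: prim_def)

lemma prim_add_1:
  assumes f: "continuous_on UNIV f" and per: "\<And>x. f (x + 1) = f x"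
  shows "prim f (x + 1) = prim f x + prim f 1"
proof -
  define h where "h = (\<lambda>x. prim f (x + 1) - prim f x)"
  have "(h has_real_derivative 0) (at x)" for x
  proof -
    have "((\<lambda>x. prim f (x + 1)) has_real_derivative f (x + 1) * 1) (at x)"
      by (rule DERIV_chain2[OF DERIV_prim[OF f]]) (auto intro!: derivative_eq_intros)
    with DERIV_prim[OF f, of x] show ?thesis
      unfolding h_def by (auto intro!: derivative_eq_intros simp: per)
  qed
  then have "h x = h 0" by (intro DERIV_isconst_all) auto
  then show ?thesis by (simp add: h_def)
qed

lemma continuous_on_prim_param:
  assumes f: "continuous_on (UNIV \<times> D) (\<lambda>(x, y). f x y)"
  shows "continuous_on (UNIV \<times> D) (\<lambda>(x, y). prim (\<lambda>x. f x y) x)"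
proof -
  have "continuous_on ((UNIV \<times> D) \<times> cbox 0 1) (\<lambda>(z, s). fst z * f (fst z * s) (snd z))"
    unfolding case_prod_unfold
    by (intro continuous_intros
        continuous_on_compose2[OF f, unfolded case_prod_unfold, of _ "\<lambda>w. (fst (fst w) * snd w, snd (fst w))", simplified])
       auto
  from integral_continuous_on_param[OF this] show ?thesis
    by (simp add: prim_def case_prod_unfold)
qed

lemma DERIV_prim_param:
  assumes D: "open D" "convex D" "y0 \<in> D"
    and der: "\<And>x y. y \<in> D \<Longrightarrow> ((\<lambda>y. f x y) has_real_derivative f1 x y) (at y)"
    and f: "continuous_on (UNIV \<times> D) (\<lambda>(x, y). f x y)"
    and f1: "continuous_on (UNIV \<times> D) (\<lambda>(x, y). f1 x y)"
  shows "((\<lambda>y. prim (\<lambda>x. f x y) x) has_real_derivative prim (\<lambda>x. f1 x y0) x) (at y0)"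
proof -
  have "((\<lambda>y. integral (cbox 0 1) (\<lambda>s. x * f (x * s) y)) has_real_derivative
        integral (cbox 0 1) (\<lambda>s. x * f1 (x * s) y0)) (at y0 within D)"
  proof (rule leibniz_rule_field_derivative[OF _ _ _ D(3,2)])
    fix y s assume "y \<in> D"
    then show "((\<lambda>y. x * f (x * s) y) has_real_derivative x * f1 (x * s) y) (at y within D)"
      using der[of y "x * s"] by (auto intro!: derivative_eq_intros dest: has_field_derivative_at_within)
  next
    fix y assume y: "y \<in> D"
    have "continuous_on (cbox 0 1) (\<lambda>s. x * f (x * s) y)"
      using y by (intro continuous_intros
        continuous_on_compose2[OF f, unfolded case_prod_unfold, of _ "\<lambda>w. (x * w, y)", simplified]) auto
    then show "(\<lambda>s. x * f (x * s) y) integrable_on cbox 0 1" by (rule integrable_continuous)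
  next
    show "continuous_on (D \<times> cbox 0 1) (\<lambda>(y, s). x * f1 (x * s) y)"
      unfolding case_prod_unfold
      by (intro continuous_intros
        continuous_on_compose2[OF f1, unfolded case_prod_unfold, of _ "\<lambda>w. (x * snd w, fst w)", simplified])
       auto
  qed
  then show ?thesis unfolding prim_def at_within_open[OF D(3,1)] cbox_interval .
qed

lemma continuous_on_compose_pair:
  assumes "continuous_on (UNIV \<times> D) (\<lambda>(x, y). f x y)"
    and "continuous_on S a" "continuous_on S b" "\<And>z. z \<in> S \<Longrightarrow> b z \<in> D"
  shows "continuous_on S (\<lambda>z. f (a z) (b z))"
  using continuous_on_compose2[OF assms(1) continuous_on_Pair[OF assms(2,3)]] assms(4) by auto

lemma integral_odd_periodic:
  fixes f :: "real \<Rightarrow> real"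
  assumes odd: "\<And>x. f (-x) = - f x" and per: "\<And>x. f (x + 1) = f x"
  shows "integral {0..1} f = 0"
proof -
  have "integral {0..1} f = integral {-1..-0} (\<lambda>x. f (-x))"
    by (rule Henstock_Kurzweil_Integration.integral_reflect_real[symmetric])
  also have "\<dots> = - integral {-1..0} f" by (simp add: odd)
  also have "integral {-1..0} f = integral {0-1..1-1} (\<lambda>x. f (x + 1))" by (simp add: per)
  also have "\<dots> = integral {0..1} f" by (rule integral_shift_real_ivl)
  finally show ?thesis by simp
qed

section \<open>Chain rule and implicit differentiation from partial derivatives\<close>

lemma mvt_between:
  fixes f f' :: "real \<Rightarrow> real"
  assumes "\<And>x. (f has_real_derivative f' x) (at x)"
  obtains \<xi> where "\<bar>\<xi> - a\<bar> \<le> \<bar>b - a\<bar>" "f b - f a = (b - a) * f' \<xi>"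
proof (cases a b rule: linorder_cases)
  case less
  from MVT2[OF less, of f f'] assms obtain z where "a < z" "z < b" "f b - f a = (b - a) * f' z" by blast
  then show ?thesis using that[of z] by auto
next
  case greater
  from MVT2[OF greater, of f f'] assms obtain z where "b < z" "z < a" "f a - f b = (a - b) * f' z" by blast
  then show ?thesis using that[of z] by (auto simp: algebra_simps)
qed (use that[of a] in auto)

text \<open>
  The mean value theorem in the first variable.  It is the common core of the chain rule and of
  implicit differentiation below: joint continuity of the partial derivative \<open>\<Phi>1\<close> makes the mean
  slope \<open>m\<close> converge.
\<close>

lemma partial_increment:
  fixes \<Phi> \<Phi>1 :: "real \<Rightarrow> real \<Rightarrow> real"
  assumes D: "open D" "y t0 \<in> D"
    and der: "\<And>x y. y \<in> D \<Longrightarrow> ((\<lambda>x. \<Phi> x y) has_real_derivative \<Phi>1 x y) (at x)"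
    and cont: "continuous_on (UNIV \<times> D) (\<lambda>(x, y). \<Phi>1 x y)"
    and h: "isCont h t0" and y: "isCont y t0"
  obtains m where "(m \<longlongrightarrow> \<Phi>1 (h t0) (y t0)) (at t0)"
    "\<forall>\<^sub>F t in at t0. \<Phi> (h t) (y t) - \<Phi> (h t0) (y t) = (h t - h t0) * m t"
proof -
  have "\<exists>\<xi>. \<forall>t. y t \<in> D \<longrightarrow> \<bar>\<xi> t - h t0\<bar> \<le> \<bar>h t - h t0\<bar> \<and>
       \<Phi> (h t) (y t) - \<Phi> (h t0) (y t) = (h t - h t0) * \<Phi>1 (\<xi> t) (y t)"
  proof (rule choice, rule allI)
    fix t
    show "\<exists>\<xi>. y t \<in> D \<longrightarrow> \<bar>\<xi> - h t0\<bar> \<le> \<bar>h t - h t0\<bar> \<and>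
       \<Phi> (h t) (y t) - \<Phi> (h t0) (y t) = (h t - h t0) * \<Phi>1 \<xi> (y t)"
      by (cases "y t \<in> D")
         (use mvt_between[of "\<lambda>x. \<Phi> x (y t)" "\<lambda>x. \<Phi>1 x (y t)" "h t0" "h t"] der in blast)+
  qed
  then obtain \<xi> where \<xi>: "\<And>t. y t \<in> D \<Longrightarrow> \<bar>\<xi> t - h t0\<bar> \<le> \<bar>h t - h t0\<bar>"
      "\<And>t. y t \<in> D \<Longrightarrow> \<Phi> (h t) (y t) - \<Phi> (h t0) (y t) = (h t - h t0) * \<Phi>1 (\<xi> t) (y t)"
    by blast
  have yl: "(y \<longlongrightarrow> y t0) (at t0)" using y by (simp add: isCont_def)
  have ev: "\<forall>\<^sub>F t in at t0. y t \<in> D" using topological_tendstoD[OF yl D] .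
  have "((\<lambda>t. h t - h t0) \<longlongrightarrow> h t0 - h t0) (at t0)" using h unfolding isCont_def by (intro tendsto_intros)
  then have "((\<lambda>t. \<bar>h t - h t0\<bar>) \<longlongrightarrow> 0) (at t0)" by (simp add: tendsto_rabs_zero_iff)
  then have "((\<lambda>t. \<xi> t - h t0) \<longlongrightarrow> 0) (at t0)"
    by (rule Lim_null_comparison[rotated]) (use ev \<xi>(1) in \<open>auto elim: eventually_mono\<close>)
  then have \<xi>l: "(\<xi> \<longlongrightarrow> h t0) (at t0)" by (simp add: LIM_zero_cancel)
  have "isCont (\<lambda>(x, y). \<Phi>1 x y) (h t0, y t0)"
    using cont D by (simp add: continuous_on_eq_continuous_at open_Times)
  from isCont_tendsto_compose[OF this tendsto_Pair[OF \<xi>l yl]]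
  have "((\<lambda>t. \<Phi>1 (\<xi> t) (y t)) \<longlongrightarrow> \<Phi>1 (h t0) (y t0)) (at t0)" by simp
  then show ?thesis by (rule that) (use ev \<xi>(2) in \<open>auto elim: eventually_mono\<close>)
qed

lemma DERIV_chain_partials:
  fixes \<Phi> \<Phi>1 :: "real \<Rightarrow> real \<Rightarrow> real"
  assumes D: "open D" "y t0 \<in> D"
    and der: "\<And>x y. y \<in> D \<Longrightarrow> ((\<lambda>x. \<Phi> x y) has_real_derivative \<Phi>1 x y) (at x)"
    and cont: "continuous_on (UNIV \<times> D) (\<lambda>(x, y). \<Phi>1 x y)"
    and der2: "((\<lambda>y. \<Phi> (h t0) y) has_real_derivative \<Phi>2) (at (y t0))"
    and h: "(h has_real_derivative h') (at t0)"
    and y: "(y has_real_derivative y') (at t0)"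
  shows "((\<lambda>t. \<Phi> (h t) (y t)) has_real_derivative h' * \<Phi>1 (h t0) (y t0) + \<Phi>2 * y') (at t0)"
proof -
  obtain m where m: "(m \<longlongrightarrow> \<Phi>1 (h t0) (y t0)) (at t0)"
    "\<forall>\<^sub>F t in at t0. \<Phi> (h t) (y t) - \<Phi> (h t0) (y t) = (h t - h t0) * m t"
    using partial_increment[OF D der cont DERIV_isCont[OF h] DERIV_isCont[OF y]] by blast
  have "((\<lambda>t. \<Phi> (h t0) (y t)) has_real_derivative \<Phi>2 * y') (at t0)"
    by (rule DERIV_chain2[OF der2 y])
  then have 2: "((\<lambda>t. (\<Phi> (h t0) (y t) - \<Phi> (h t0) (y t0)) / (t - t0)) \<longlongrightarrow> \<Phi>2 * y') (at t0)"
    by (simp add: has_field_derivative_iff)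
  have "((\<lambda>t. (h t - h t0) / (t - t0) * m t + (\<Phi> (h t0) (y t) - \<Phi> (h t0) (y t0)) / (t - t0))
      \<longlongrightarrow> h' * \<Phi>1 (h t0) (y t0) + \<Phi>2 * y') (at t0)"
    using h by (intro tendsto_add tendsto_mult m 2) (simp add: has_field_derivative_iff)
  moreover have "\<forall>\<^sub>F t in at t0. (h t - h t0) / (t - t0) * m t
       + (\<Phi> (h t0) (y t) - \<Phi> (h t0) (y t0)) / (t - t0)
     = (\<Phi> (h t) (y t) - \<Phi> (h t0) (y t0)) / (t - t0)"
    using m(2) by eventually_elim (simp add: add_divide_distrib[symmetric])
  ultimately show ?thesis
    unfolding has_field_derivative_iff by (rule Lim_transform_eventually)
qed

text \<open>
  On the level curve the increments in the two variables cancel: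
  \<open>G (h y) y - G (h y0) y = - (G (h y0) y - G (h y0) y0)\<close>.  Dividing by \<open>y - y0\<close> and by the mean slope
  gives the derivative.
\<close>

lemma DERIV_implicit:
  fixes G g :: "real \<Rightarrow> real \<Rightarrow> real"
  assumes D: "open D" "y0 \<in> D"
    and der: "\<And>x y. y \<in> D \<Longrightarrow> ((\<lambda>x. G x y) has_real_derivative g x y) (at x)"
    and cont: "continuous_on (UNIV \<times> D) (\<lambda>(x, y). g x y)"
    and nz: "g (h y0) y0 \<noteq> 0"
    and der2: "((\<lambda>y. G (h y0) y) has_real_derivative k) (at y0)"
    and h: "isCont h y0" and eq: "\<And>y. y \<in> D \<Longrightarrow> G (h y) y = c"
  shows "(h has_real_derivative - k / g (h y0) y0) (at y0)"
proof -
  obtain m where m: "(m \<longlongrightarrow> g (h y0) y0) (at y0)"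
    "\<forall>\<^sub>F y in at y0. G (h y) y - G (h y0) y = (h y - h y0) * m y"
    using partial_increment[OF D(1), of "\<lambda>y. y" y0 G g h] D der cont h by auto
  have ev: "\<forall>\<^sub>F y in at y0. y \<in> D"
    using D by (rule topological_tendstoD[OF tendsto_ident_at])
  have nz': "\<forall>\<^sub>F y in at y0. m y \<noteq> 0"
    using tendsto_imp_eventually_ne[OF m(1) nz] .
  have "((\<lambda>y. - ((G (h y0) y - G (h y0) y0) / (y - y0)) / m y) \<longlongrightarrow> - k / g (h y0) y0) (at y0)"
    using der2 nz by (intro tendsto_divide tendsto_minus m(1)) (simp_all add: has_field_derivative_iff)
  moreover have "\<forall>\<^sub>F y in at y0. - ((G (h y0) y - G (h y0) y0) / (y - y0)) / m y = (h y - h y0) / (y - y0)"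
    using m(2) ev nz'
  proof eventually_elim
    case (elim y)
    then have "(h y - h y0) * m y = - (G (h y0) y - G (h y0) y0)" using eq[of y] eq[OF D(2)] by simp
    then have "h y - h y0 = - (G (h y0) y - G (h y0) y0) / m y" using elim by (simp add: field_simps)
    then show ?case by (simp add: mult.commute minus_divide_left)
  qed
  ultimately show ?thesis
    unfolding has_field_derivative_iff by (rule Lim_transform_eventually)
qed

section \<open>Inverses of increasing functions\<close>

text \<open>
  Monotonicity turns continuity of the inverse into inequalities between values of \<open>G\<close>:
  \<open>a < H x y\<close> iff \<open>G a y < x\<close>, an open condition on \<open>(x, y)\<close> for each fixed \<open>a\<close>.
\<close>

lemma continuous_on_level_curve:
  fixes G :: "real \<Rightarrow> real \<Rightarrow> real"
  assumes D: "open D"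
    and mono: "\<And>y. y \<in> D \<Longrightarrow> strict_mono (\<lambda>x. G x y)"
    and cont: "\<And>x. continuous_on D (\<lambda>y. G x y)"
    and eq: "\<And>x y. y \<in> D \<Longrightarrow> G (H x y) y = x"
  shows "continuous_on (UNIV \<times> D) (\<lambda>(x, y). H x y)"
proof -
  have "((\<lambda>(x, y). H x y) \<longlongrightarrow> H x0 y0) (at (x0, y0))" if y0: "y0 \<in> D" for x0 y0
  proof (rule order_tendstoI)
    have fl: "((\<lambda>z. z) \<longlongrightarrow> (x0, y0)) (at (x0, y0))" by (rule tendsto_ident_at)
    have evD: "\<forall>\<^sub>F z in at (x0, y0). snd z \<in> D"
      using topological_tendstoD[OF tendsto_snd[OF fl] D] y0 by simp
    have Gt: "((\<lambda>z. G a (snd z)) \<longlongrightarrow> G a y0) (at (x0, y0))" for a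
    proof -
      have "isCont (\<lambda>y. G a y) y0" using cont[of a] D y0 by (simp add: continuous_on_eq_continuous_at)
      from isCont_tendsto_compose[OF this, of snd] tendsto_snd[OF fl] show ?thesis by simp
    qed
    note df = tendsto_diff[OF tendsto_fst[OF fl] Gt, simplified]
    {
      fix a assume "a < H x0 y0"
      then have "0 < x0 - G a y0" using strict_monoD[OF mono[OF y0]] eq[OF y0, of x0] by fastforce
      from order_tendstoD(1)[OF df this] evD
      show "\<forall>\<^sub>F z in at (x0, y0). a < (case z of (x, y) \<Rightarrow> H x y)"
      proof eventually_elim
        case (elim z)
        then have "G a (snd z) < G (H (fst z) (snd z)) (snd z)" using eq by simp
        then show ?case using strict_mono_less[OF mono[OF elim(2)]] by (simp add: case_prod_unfold)
      qed
    next
      fix a assume "H x0 y0 < a"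
      then have "x0 - G a y0 < 0" using strict_monoD[OF mono[OF y0]] eq[OF y0, of x0] by fastforce
      from order_tendstoD(2)[OF df this] evD
      show "\<forall>\<^sub>F z in at (x0, y0). (case z of (x, y) \<Rightarrow> H x y) < a"
      proof eventually_elim
        case (elim z)
        then have "G (H (fst z) (snd z)) (snd z) < G a (snd z)" using eq by simp
        then show ?case using strict_mono_less[OF mono[OF elim(2)]] by (simp add: case_prod_unfold)
      qed
    }
  qed
  then show ?thesis using D
    by (auto simp: continuous_on_eq_continuous_at open_Times isCont_def)
qed

lemma strict_mono_DERIV_pos:
  fixes f :: "real \<Rightarrow> real"
  assumes "\<And>x. (f has_real_derivative f' x) (at x)" "\<And>x. 0 < f' x"
  shows "strict_mono f"
  by (rule strict_monoI) (use assms DERIV_pos_imp_increasing in blast)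

lemma surj_of_unbounded:
  fixes f :: "real \<Rightarrow> real"
  assumes "continuous_on UNIV f" "\<And>y. \<exists>a. f a \<le> y" "\<And>y. \<exists>b. y \<le> f b"
  shows "surj f"
proof -
  have "\<exists>x. f x = y" for y
  proof -
    obtain a b where ab: "f a \<le> y" "y \<le> f b" using assms by blast
    have "connected (range f)" using assms(1) by (intro connected_continuous_image) auto
    then have "{f a..f b} \<subseteq> range f" by (rule connected_contains_Icc) auto
    then have "y \<in> range f" using ab by auto
    then show ?thesis by auto
  qed
  then show ?thesis by (metis surjI)
qed

lemma DERIV_inv:
  fixes f :: "real \<Rightarrow> real"
  assumes der: "\<And>x. (f has_real_derivative f' x) (at x)" and pos: "\<And>x. 0 < f' x" and surj: "surj f"
  shows "(inv f has_real_derivative 1 / f' (inv f y)) (at y)"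
proof -
  have m: "strict_mono f" using strict_mono_DERIV_pos[OF der pos] .
  have "continuous_on (UNIV \<times> (UNIV::real set)) (\<lambda>(x, y). inv f x)"
    by (rule continuous_on_level_curve[where G="\<lambda>x y. f x"]) (use m surj in \<open>auto simp: surj_f_inv_f\<close>)
  then have "continuous_on UNIV (\<lambda>x. (\<lambda>(x, y). inv f x) (x, 0::real))"
    by (rule continuous_on_compose2) (auto intro!: continuous_intros)
  then have "isCont (inv f) y" by (simp add: continuous_on_eq_continuous_at)
  then have "(inv f has_real_derivative inverse (f' (inv f y))) (at y)"
    by (intro DERIV_inverse_function[OF der, where a="y-1" and b="y+1"])
       (use pos[of "inv f y"] surj in \<open>auto simp: surj_f_inv_f\<close>)
  then show ?thesis by (simp add: inverse_eq_divide)
qed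

section \<open>The flow generated by odd data\<close>

text \<open>
  Throughout, \<open>y\<close> stands for a value of \<open>\<eta>\<close>.  It ranges over an open interval containing 0 so
  that derivatives at the initial time are two-sided.  The functions \<open>v\<close> and \<open>v'\<close>
  are the first two derivatives of \<open>u0\<close>.
\<close>

locale odd_data =
  fixes lam \<kappa> :: real and u0 \<rho>0 v v' \<rho>0' :: "real \<Rightarrow> real" and el eh :: real
  assumes lam_nz: "lam \<noteq> 0"
    and el: "el < 0" and eh: "0 < eh"
    and DERIV_u0: "\<And>x. (u0 has_real_derivative v x) (at x)"
    and DERIV_v: "\<And>x. (v has_real_derivative v' x) (at x)"
    and cont_v': "continuous_on UNIV v'"
    and DERIV_\<rho>0: "\<And>x. (\<rho>0 has_real_derivative \<rho>0' x) (at x)"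
    and cont_\<rho>0': "continuous_on UNIV \<rho>0'"
    and u0_add_1: "\<And>x. u0 (x + 1) = u0 x" and \<rho>0_add_1: "\<And>x. \<rho>0 (x + 1) = \<rho>0 x"
    and u0_odd: "\<And>x. u0 (-x) = - u0 x" and \<rho>0_even: "\<And>x. \<rho>0 (-x) = \<rho>0 x"
    and Q_pos: "\<And>x y. y \<in> {el<..<eh} \<Longrightarrow> 0 < Q lam \<kappa> u0 \<rho>0 x y"
begin

abbreviation "D \<equiv> {el<..<eh}"
abbreviation "C \<equiv> C_fun lam \<kappa> u0 \<rho>0"
abbreviation "QQ \<equiv> Q lam \<kappa> u0 \<rho>0"

definition "p = - 1 / (2 * lam)"

lemma p_lam: "p * lam = - 1 / 2" and p_nz: "p \<noteq> 0"
  using lam_nz by (auto simp: p_def)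

lemma deriv_u0: "deriv u0 = v"
  using DERIV_u0 by (auto intro: DERIV_imp_deriv)

lemma v_add_1: "v (x + 1) = v x"
proof -
  have "((\<lambda>x. u0 (x + 1)) has_real_derivative v (x + 1) * 1) (at x)"
    by (rule DERIV_chain2[OF DERIV_u0]) (auto intro!: derivative_eq_intros)
  then have "(u0 has_real_derivative v (x + 1)) (at x)" by (simp add: u0_add_1)
  then show ?thesis using DERIV_u0 DERIV_unique by blast
qed

lemma v_even: "v (-x) = v x"
proof -
  have "((\<lambda>x. u0 (-x)) has_real_derivative v (-x) * (-1)) (at x)"
    by (rule DERIV_chain2[OF DERIV_u0]) (auto intro!: derivative_eq_intros)
  then have "((\<lambda>x. - u0 x) has_real_derivative - v (-x)) (at x)" by (simp add: u0_odd)
  from DERIV_minus[OF this] have "(u0 has_real_derivative v (-x)) (at x)" by simp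
  then show ?thesis using DERIV_u0 DERIV_unique by blast
qed

lemma continuous_on_v [continuous_intros]:
  "continuous_on S f \<Longrightarrow> continuous_on S (\<lambda>z. v (f z))"
  by (rule continuous_on_compose2[of UNIV v])
     (auto intro: DERIV_continuous_on has_field_derivative_at_within DERIV_v)

lemma continuous_on_v' [continuous_intros]:
  "continuous_on S f \<Longrightarrow> continuous_on S (\<lambda>z. v' (f z))"
  by (rule continuous_on_compose2[OF cont_v']) auto

lemma continuous_on_\<rho>0 [continuous_intros]:
  "continuous_on S f \<Longrightarrow> continuous_on S (\<lambda>z. \<rho>0 (f z))"
  by (rule continuous_on_compose2[of UNIV \<rho>0])
     (auto intro: DERIV_continuous_on has_field_derivative_at_within DERIV_\<rho>0)

lemma continuous_on_\<rho>0' [continuous_intros]: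
  "continuous_on S f \<Longrightarrow> continuous_on S (\<lambda>z. \<rho>0' (f z))"
  by (rule continuous_on_compose2[OF cont_\<rho>0']) auto

lemma C_eq: "C x = lam * (lam * (v x)\<^sup>2 - \<kappa> * (\<rho>0 x)\<^sup>2)"
  by (simp add: C_fun_def deriv_u0)

lemma Q_eq: "QQ x y = C x * y\<^sup>2 - 2 * lam * v x * y + 1"
  by (simp add: Q_def deriv_u0)

text \<open>
  Subscripts \<open>x\<close> and \<open>y\<close> denote partial derivatives with respect to the label \<open>\<alpha>\<close> and to \<open>\<eta>\<close>.
\<close>

definition "C' x = 2 * lam * (lam * v x * v' x - \<kappa> * \<rho>0 x * \<rho>0' x)"
definition "Qy x y = 2 * C x * y - 2 * lam * v x"
definition "Qyy x = 2 * C x"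
definition "Qx x y = C' x * y\<^sup>2 - 2 * lam * v' x * y"
definition "Qxy x y = 2 * C' x * y - 2 * lam * v' x"

lemma continuous_on_C [continuous_intros]:
  "continuous_on S f \<Longrightarrow> continuous_on S (\<lambda>z. C (f z))"
  unfolding C_eq by (intro continuous_intros)

lemma continuous_on_Q [continuous_intros]:
  assumes "continuous_on S f" "continuous_on S g"
  shows "continuous_on S (\<lambda>z. QQ (f z) (g z))" "continuous_on S (\<lambda>z. Qy (f z) (g z))"
    "continuous_on S (\<lambda>z. Qyy (f z))" "continuous_on S (\<lambda>z. Qx (f z) (g z))"
    "continuous_on S (\<lambda>z. Qxy (f z) (g z))"
  unfolding Q_eq Qy_def Qyy_def Qx_def Qxy_def C'_def by (intro continuous_intros assms)+

lemma DERIV_C: "(C has_real_derivative C' x) (at x)"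
  unfolding C_eq C'_def
  by (auto intro!: derivative_eq_intros DERIV_v DERIV_\<rho>0 simp: algebra_simps power2_eq_square)

lemma DERIV_Q_y: "((\<lambda>y. QQ x y) has_real_derivative Qy x y) (at y)"
  and DERIV_Qy_y: "((\<lambda>y. Qy x y) has_real_derivative Qyy x) (at y)"
  and DERIV_Q_x: "((\<lambda>x. QQ x y) has_real_derivative Qx x y) (at x)"
  and DERIV_Qy_x: "((\<lambda>x. Qy x y) has_real_derivative Qxy x y) (at x)"
  unfolding Q_eq Qy_def Qyy_def Qx_def Qxy_def
  by (auto intro!: derivative_eq_intros DERIV_v DERIV_C)

lemma Q_add_1: "QQ (x + 1) y = QQ x y" and Qy_add_1: "Qy (x + 1) y = Qy x y"
  and Q_even: "QQ (-x) y = QQ x y" and Qy_even: "Qy (-x) y = Qy x y"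
  by (simp_all add: Q_eq Qy_def C_eq v_add_1 v_even \<rho>0_add_1 \<rho>0_even)

text \<open>
  Unnormalised Jacobian of the flow, with its first two derivatives in \<open>\<eta>\<close>; the letters \<open>F\<close>, \<open>P\<close>, \<open>G\<close>
  and \<open>E\<close> below use the suffixes 1 and 2 in the same way.
\<close>

definition "q x y = QQ x y powr p"
definition "q1 x y = p * QQ x y powr (p - 1) * Qy x y"
definition "q2 x y = p * (p - 1) * QQ x y powr (p - 2) * (Qy x y)\<^sup>2 + p * QQ x y powr (p - 1) * Qyy x"

lemma q_pos: "y \<in> D \<Longrightarrow> 0 < q x y"
  using Q_pos[of y x] by (simp add: q_def)

lemma q1_eq: "y \<in> D \<Longrightarrow> q1 x y = p * (Qy x y / QQ x y) * q x y"
  using Q_pos[of y x] by (simp add: q1_def q_def powr_diff)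

lemma q2_eq: "y \<in> D \<Longrightarrow>
    q2 x y = (p * (p - 1) * (Qy x y / QQ x y)\<^sup>2 + p * (Qyy x / QQ x y)) * q x y"
  using Q_pos[of y x]
  by (simp add: q2_def q_def powr_diff powr_numeral power_divide algebra_simps)

lemma DERIV_q_y: "y \<in> D \<Longrightarrow> ((\<lambda>y. q x y) has_real_derivative q1 x y) (at y)"
  unfolding q_def q1_def using DERIV_fun_powr[OF DERIV_Q_y, of x y p] Q_pos[of y x] by simp

lemma DERIV_q1_y: "y \<in> D \<Longrightarrow> ((\<lambda>y. q1 x y) has_real_derivative q2 x y) (at y)"
  unfolding q1_def q2_def using DERIV_fun_powr[OF DERIV_Q_y, of x y "p - 1"] Q_pos[of y x]
  by (auto intro!: DERIV_mult[THEN DERIV_cong] DERIV_cmult DERIV_Qy_y simp: power2_eq_square algebra_simps)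

lemma continuous_on_q:
  "continuous_on (UNIV \<times> D) (\<lambda>(x, y). q x y)" "continuous_on (UNIV \<times> D) (\<lambda>(x, y). q1 x y)"
  "continuous_on (UNIV \<times> D) (\<lambda>(x, y). q2 x y)"
proof -
  have nz: "QQ (fst z) (snd z) \<noteq> 0" if "z \<in> UNIV \<times> D" for z
    using Q_pos[of "snd z" "fst z"] that by auto
  then show "continuous_on (UNIV \<times> D) (\<lambda>(x, y). q x y)"
    "continuous_on (UNIV \<times> D) (\<lambda>(x, y). q1 x y)" "continuous_on (UNIV \<times> D) (\<lambda>(x, y). q2 x y)"
    unfolding q_def q1_def q2_def case_prod_unfold by (intro continuous_intros; force)+
qed

lemma q_even: "q (-x) y = q x y" "q1 (-x) y = q1 x y"
  and q_add_1: "q (x + 1) y = q x y" "q1 (x + 1) y = q1 x y"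
  by (simp_all add: q_def q1_def Q_even Qy_even Q_add_1 Qy_add_1)

definition "F x y = prim (\<lambda>x. q x y) x"
definition "F1 x y = prim (\<lambda>x. q1 x y) x"
definition "P y = F 1 y"
definition "P1 y = F1 1 y"
definition "P2 y = prim (\<lambda>x. q2 x y) 1"

lemma P0_bar_eq: "P0_bar lam \<kappa> u0 \<rho>0 y = P y"
  by (simp add: P0_bar_def P_def F_def prim_1 q_def p_def)

lemma continuous_on_slice:
  assumes "continuous_on (UNIV \<times> D) (\<lambda>(x, y). f x y)" "y \<in> D" "continuous_on S a"
  shows "continuous_on S (\<lambda>x. f (a x) y)"
  by (rule continuous_on_compose_pair[OF assms(1)]) (use assms in \<open>auto intro!: continuous_intros\<close>)

lemma DERIV_F_x: "y \<in> D \<Longrightarrow> ((\<lambda>x. F x y) has_real_derivative q x y) (at x)"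
  unfolding F_def by (rule DERIV_prim) (intro continuous_on_slice[OF continuous_on_q(1)] continuous_intros)

lemma DERIV_F1_x: "y \<in> D \<Longrightarrow> ((\<lambda>x. F1 x y) has_real_derivative q1 x y) (at x)"
  unfolding F1_def by (rule DERIV_prim) (intro continuous_on_slice[OF continuous_on_q(2)] continuous_intros)

lemma DERIV_F_y: "y \<in> D \<Longrightarrow> ((\<lambda>y. F x y) has_real_derivative F1 x y) (at y)"
  unfolding F_def F1_def
  by (rule DERIV_prim_param[OF _ _ _ DERIV_q_y continuous_on_q(1,2)]) auto

lemma DERIV_P: "y \<in> D \<Longrightarrow> (P has_real_derivative P1 y) (at y)"
  unfolding P_def P1_def by (rule DERIV_F_y)

lemma DERIV_P1: "y \<in> D \<Longrightarrow> (P1 has_real_derivative P2 y) (at y)"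
  unfolding P1_def P2_def F1_def
  by (rule DERIV_prim_param[OF _ _ _ DERIV_q1_y continuous_on_q(2,3)]) auto

lemma continuous_on_F: "continuous_on (UNIV \<times> D) (\<lambda>(x, y). F x y)"
  and continuous_on_F1: "continuous_on (UNIV \<times> D) (\<lambda>(x, y). F1 x y)"
  unfolding F_def F1_def by (intro continuous_on_prim_param continuous_on_q)+

lemma continuous_on_P [continuous_intros]:
  assumes "continuous_on S f" "\<And>z. z \<in> S \<Longrightarrow> f z \<in> D"
  shows "continuous_on S (\<lambda>z. P (f z))" "continuous_on S (\<lambda>z. P1 (f z))" "continuous_on S (\<lambda>z. P2 (f z))"
  unfolding P_def P1_def P2_def
  by (intro continuous_on_compose_pair[OF continuous_on_F] continuous_on_compose_pair[OF continuous_on_F1]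
      continuous_on_compose_pair[OF continuous_on_prim_param[OF continuous_on_q(3)]] assms continuous_intros; simp)+

lemma F_0 [simp]: "F 0 y = 0" "F1 0 y = 0"
  by (simp_all add: F_def F1_def)

lemma F_odd: "F (-x) y = - F x y" "F1 (-x) y = - F1 x y"
  by (simp_all add: F_def F1_def prim_odd q_even)

lemma F_add_1: "y \<in> D \<Longrightarrow> F (x + 1) y = F x y + P y" "y \<in> D \<Longrightarrow> F1 (x + 1) y = F1 x y + P1 y"
  unfolding F_def F1_def P_def P1_def
  by (rule prim_add_1; intro continuous_on_slice[OF continuous_on_q(1)] continuous_on_slice[OF continuous_on_q(2)] continuous_intros q_add_1; assumption)+

lemma P_pos: "y \<in> D \<Longrightarrow> 0 < P y"
  using strict_monoD[OF strict_mono_DERIV_pos[of "\<lambda>x. F x y" "\<lambda>x. q x y"], of 0 1] DERIV_F_x q_pos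
  by (simp add: P_def)

text \<open>
  \<open>G \<alpha> \<eta>\<close> is the position of the characteristic with label \<open>\<alpha>\<close>, and \<open>g\<close> its Jacobian.  Dividing by \<open>P\<close>
  makes the flow commute with integer translations (\<open>G_add_1\<close>).
\<close>

definition "G x y = F x y / P y"
definition "G1 x y = F1 x y / P y - F x y * P1 y / (P y)\<^sup>2"
definition "g x y = q x y / P y"

lemma g_pos: "y \<in> D \<Longrightarrow> 0 < g x y"
  by (simp add: g_def q_pos P_pos)

lemma DERIV_G_x: "y \<in> D \<Longrightarrow> ((\<lambda>x. G x y) has_real_derivative g x y) (at x)"
  unfolding G_def g_def by (intro DERIV_cdivide DERIV_F_x)

lemma DERIV_G_y: "y \<in> D \<Longrightarrow> ((\<lambda>y. G x y) has_real_derivative G1 x y) (at y)"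
  unfolding G_def G1_def using P_pos[of y]
  by (auto intro!: derivative_eq_intros DERIV_F_y DERIV_P simp: field_simps power2_eq_square)

lemma continuous_on_G:
  "continuous_on (UNIV \<times> D) (\<lambda>(x, y). G x y)" "continuous_on (UNIV \<times> D) (\<lambda>(x, y). G1 x y)"
  "continuous_on (UNIV \<times> D) (\<lambda>(x, y). g x y)"
proof -
  note [continuous_intros] = continuous_on_F[unfolded case_prod_unfold]
    continuous_on_F1[unfolded case_prod_unfold] continuous_on_q(1)[unfolded case_prod_unfold]
  have "P (snd z) \<noteq> 0" if "z \<in> UNIV \<times> D" for z :: "real \<times> real" using P_pos that by fastforce
  then show "continuous_on (UNIV \<times> D) (\<lambda>(x, y). G x y)" "continuous_on (UNIV \<times> D) (\<lambda>(x, y). G1 x y)"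
    "continuous_on (UNIV \<times> D) (\<lambda>(x, y). g x y)"
    unfolding G_def G1_def g_def case_prod_unfold by (intro continuous_intros; force)+
qed

lemma G_add_1: "y \<in> D \<Longrightarrow> G (x + 1) y = G x y + 1" "y \<in> D \<Longrightarrow> G1 (x + 1) y = G1 x y"
  using P_pos[of y]
  by (simp_all add: G_def G1_def F_add_1 add_divide_distrib power2_eq_square distrib_right)

lemma G_odd: "G (-x) y = - G x y" "G1 (-x) y = - G1 x y"
  by (simp_all add: G_def G1_def F_odd)

lemma strict_mono_G: "y \<in> D \<Longrightarrow> strict_mono (\<lambda>x. G x y)"
  using strict_mono_DERIV_pos[of "\<lambda>x. G x y" "\<lambda>x. g x y"] DERIV_G_x g_pos by blast

lemma G_of_nat: "y \<in> D \<Longrightarrow> G (of_nat n) y = of_nat n"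
proof (induction n)
  case (Suc n)
  then show ?case using G_add_1(1)[of y "of_nat n"] by (simp add: add.commute)
qed (simp add: G_def)

lemma surj_G: assumes y: "y \<in> D" shows "surj (\<lambda>x. G x y)"
proof (rule surj_of_unbounded)
  show "continuous_on UNIV (\<lambda>x. G x y)"
    by (intro continuous_on_slice[OF continuous_on_G(1) y] continuous_intros)
  show "\<exists>b. z \<le> G b y" for z
    using real_arch_simple[of z] G_of_nat[OF y] by metis
  show "\<exists>a. G a y \<le> z" for z
  proof -
    obtain n :: nat where "- z \<le> of_nat n" using real_arch_simple by blast
    then have "G (- of_nat n) y \<le> z" using G_of_nat[OF y, of n] G_odd(1)[of "of_nat n" y] by simp
    then show ?thesis by blast
  qed
qed

text \<open>
  The label of the characteristic that passes through \<open>x\<close>.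
\<close>

definition "H x y = inv (\<lambda>x. G x y) x"

lemma G_H: "y \<in> D \<Longrightarrow> G (H x y) y = x"
  unfolding H_def using surj_f_inv_f[OF surj_G] by blast

lemma H_G: "y \<in> D \<Longrightarrow> H (G x y) y = x"
  unfolding H_def using inv_f_f[OF strict_mono_imp_inj_on[OF strict_mono_G]] by fastforce

lemma H_eqI: "y \<in> D \<Longrightarrow> G x' y = x \<Longrightarrow> H x y = x'"
  using H_G by blast

lemma H_add_1: "y \<in> D \<Longrightarrow> H (x + 1) y = H x y + 1"
  by (rule H_eqI) (simp_all add: G_add_1 G_H)

lemma H_odd: "y \<in> D \<Longrightarrow> H (-x) y = - H x y"
  by (rule H_eqI) (simp_all add: G_odd G_H)

lemma H_0: "y \<in> D \<Longrightarrow> H 0 y = 0" and H_1: "y \<in> D \<Longrightarrow> H 1 y = 1"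
  using G_of_nat[of y 0] G_of_nat[of y 1] by (auto intro: H_eqI)

lemma continuous_on_H: "continuous_on (UNIV \<times> D) (\<lambda>(x, y). H x y)"
  by (rule continuous_on_level_curve[OF _ strict_mono_G continuous_on_compose_pair[OF continuous_on_G(1)] G_H])
     (auto intro!: continuous_intros)

lemma DERIV_H_x: "y \<in> D \<Longrightarrow> ((\<lambda>x. H x y) has_real_derivative 1 / g (H x y) y) (at x)"
  unfolding H_def by (intro DERIV_inv DERIV_G_x g_pos surj_G)

lemma DERIV_H_y:
  assumes y: "y \<in> D"
  shows "((\<lambda>y. H x y) has_real_derivative - G1 (H x y) y / g (H x y) y) (at y)"
proof (rule DERIV_implicit[where h="\<lambda>y. H x y" and G=G and g=g and D=D and c=x])
  show "continuous_on (UNIV \<times> D) (\<lambda>(x, y). g x y)" by (rule continuous_on_G)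
  have "continuous_on D (\<lambda>y. H x y)"
    by (rule continuous_on_compose_pair[OF continuous_on_H]) (auto intro!: continuous_intros)
  then show "isCont (\<lambda>y. H x y) y" using y by (simp add: continuous_on_eq_continuous_at)
  show "g (H x y) y \<noteq> 0" using g_pos[OF y, of "H x y"] by simp
qed (use y in \<open>auto intro!: DERIV_G_x DERIV_G_y G_H\<close>)

text \<open>
  The speed \<open>d\<eta>/dt\<close>.
\<close>

definition "E y = P y powr (- 2 * lam)"
definition "E1 y = - 2 * lam * E y * P1 y / P y"

lemma DERIV_E: "y \<in> D \<Longrightarrow> (E has_real_derivative E1 y) (at y)"
  unfolding E_def E1_def using DERIV_fun_powr[OF DERIV_P, of y "- 2 * lam"] P_pos[of y]
  by (simp add: powr_diff)

lemma continuous_on_E [continuous_intros]: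
  assumes "continuous_on S f" "\<And>z. z \<in> S \<Longrightarrow> f z \<in> D"
  shows "continuous_on S (\<lambda>z. E (f z))" "continuous_on S (\<lambda>z. E1 (f z))"
  unfolding E_def E1_def using P_pos[OF assms(2)]
  by (intro continuous_intros assms; force)+

text \<open>
  \<open>W\<close> is the derivative of \<open>ln g\<close> in \<open>\<eta>\<close>.  The velocity gradient along a characteristic is the time derivative
  of \<open>ln g\<close>, so it equals \<open>E W\<close>.
\<close>

definition "W x y = p * (Qy x y / QQ x y) - P1 y / P y"
definition "Wx x y = p * (Qxy x y * QQ x y - Qy x y * Qx x y) / (QQ x y)\<^sup>2"
definition "Wy x y = p * (Qyy x / QQ x y - (Qy x y / QQ x y)\<^sup>2) - (P2 y / P y - (P1 y / P y)\<^sup>2)"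

lemma DERIV_W_x: "y \<in> D \<Longrightarrow> ((\<lambda>x. W x y) has_real_derivative Wx x y) (at x)"
  unfolding W_def Wx_def using Q_pos[of y x]
  by (auto intro!: derivative_eq_intros DERIV_Q_x DERIV_Qy_x simp: power2_eq_square algebra_simps)

lemma DERIV_W_y: "y \<in> D \<Longrightarrow> ((\<lambda>y. W x y) has_real_derivative Wy x y) (at y)"
  unfolding W_def Wy_def using Q_pos[of y x] P_pos[of y]
  by (auto intro!: derivative_eq_intros DERIV_Q_y DERIV_Qy_y DERIV_P DERIV_P1
      simp: power2_eq_square field_simps)

lemma DERIV_G1_x:
  assumes y: "y \<in> D"
  shows "((\<lambda>x. G1 x y) has_real_derivative g x y * W x y) (at x)"
proof -
  have "((\<lambda>x. G1 x y) has_real_derivative q1 x y / P y - q x y * P1 y / (P y)\<^sup>2) (at x)"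
    unfolding G1_def using DERIV_F_x[OF y] DERIV_F1_x[OF y]
    by (intro DERIV_diff DERIV_cdivide DERIV_cmult_right) auto
  then show ?thesis
    using P_pos[OF y] by (simp add: q1_eq[OF y] g_def W_def algebra_simps power2_eq_square)
qed

text \<open>
  \<open>V\<close> and \<open>R\<close> are the values of \<open>u\<^sub>x\<close> and \<open>\<rho>\<close> as functions of label and \<open>\<eta>\<close>.
\<close>

definition "V x y = E y * W x y"
definition "Vx x y = E y * Wx x y"
definition "Vy x y = E1 y * W x y + E y * Wy x y"
definition "R x y = E y * (\<rho>0 x / QQ x y)"
definition "Rx x y = E y * ((\<rho>0' x * QQ x y - \<rho>0 x * Qx x y) / (QQ x y)\<^sup>2)"
definition "Ry x y = E1 y * (\<rho>0 x / QQ x y) - E y * (\<rho>0 x * Qy x y / (QQ x y)\<^sup>2)"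

lemma DERIV_V_x: "y \<in> D \<Longrightarrow> ((\<lambda>x. V x y) has_real_derivative Vx x y) (at x)"
  unfolding V_def Vx_def by (intro DERIV_cmult DERIV_W_x)

lemma DERIV_V_y: "y \<in> D \<Longrightarrow> ((\<lambda>y. V x y) has_real_derivative Vy x y) (at y)"
  unfolding V_def Vy_def
  by (auto intro!: derivative_eq_intros DERIV_E DERIV_W_y)

lemma DERIV_R_x: "y \<in> D \<Longrightarrow> ((\<lambda>x. R x y) has_real_derivative Rx x y) (at x)"
  unfolding R_def Rx_def using Q_pos[of y x]
  by (intro DERIV_cmult) (auto intro!: derivative_eq_intros DERIV_\<rho>0 DERIV_Q_x simp: power2_eq_square)

lemma DERIV_R_y: "y \<in> D \<Longrightarrow> ((\<lambda>y. R x y) has_real_derivative Ry x y) (at y)"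
  unfolding R_def Ry_def using Q_pos[of y x]
  by (auto intro!: derivative_eq_intros DERIV_E DERIV_Q_y simp: power2_eq_square diff_divide_distrib)

lemma continuous_on_VR:
  "continuous_on (UNIV \<times> D) (\<lambda>(x, y). V x y)" "continuous_on (UNIV \<times> D) (\<lambda>(x, y). Vx x y)"
  "continuous_on (UNIV \<times> D) (\<lambda>(x, y). Vy x y)" "continuous_on (UNIV \<times> D) (\<lambda>(x, y). R x y)"
  "continuous_on (UNIV \<times> D) (\<lambda>(x, y). Rx x y)" "continuous_on (UNIV \<times> D) (\<lambda>(x, y). Ry x y)"
proof -
  have nz: "QQ (fst z) (snd z) \<noteq> 0" "P (snd z) \<noteq> 0" "(QQ (fst z) (snd z))\<^sup>2 \<noteq> 0" "snd z \<in> D"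
    if "z \<in> UNIV \<times> D" for z
    using Q_pos[of "snd z" "fst z"] P_pos[of "snd z"] that by auto
  show "continuous_on (UNIV \<times> D) (\<lambda>(x, y). V x y)" "continuous_on (UNIV \<times> D) (\<lambda>(x, y). Vx x y)"
    "continuous_on (UNIV \<times> D) (\<lambda>(x, y). Vy x y)" "continuous_on (UNIV \<times> D) (\<lambda>(x, y). R x y)"
    "continuous_on (UNIV \<times> D) (\<lambda>(x, y). Rx x y)" "continuous_on (UNIV \<times> D) (\<lambda>(x, y). Ry x y)"
    unfolding V_def Vx_def Vy_def R_def Rx_def Ry_def W_def Wx_def Wy_def case_prod_unfold
    by (intro continuous_intros; use nz in blast)+
qed

lemma ux_formula_eq:
  assumes y: "y \<in> D"
  shows "ux_formula lam \<kappa> u0 \<rho>0 x y = V x y"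
proof -
  have 1: "(lam * v x - y * C x) / lam = p * Qy x y" for x
    using lam_nz by (simp add: p_def Qy_def field_simps)
  have 2: "(lam * v x - y * C x) / QQ x y powr (1 + 1 / (2 * lam)) = lam * q1 x y" for x
  proof -
    have "p - 1 = - (1 + 1 / (2 * lam))" by (simp add: p_def)
    then have "QQ x y powr (p - 1) = 1 / QQ x y powr (1 + 1 / (2 * lam))"
      by (simp only: powr_minus_divide)
    then have "q1 x y = (lam * v x - y * C x) / lam / QQ x y powr (1 + 1 / (2 * lam))"
      unfolding 1 by (simp add: q1_def)
    then show ?thesis using lam_nz by simp
  qed
  have 3: "integral {0..1} (\<lambda>x. (lam * v x - y * C x) / QQ x y powr (1 + 1 / (2 * lam))) = lam * P1 y"
    by (simp only: 2 P1_def F1_def prim_1 integral_mult_right)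
  have "ux_formula lam \<kappa> u0 \<rho>0 x y =
      E y * ((lam * v x - y * C x) / lam / QQ x y - P1 y / P y)"
    unfolding ux_formula_def P0_bar_eq deriv_u0 3 E_def[symmetric] using lam_nz by (simp add: field_simps)
  then show ?thesis unfolding 1 by (simp add: V_def W_def)
qed

lemma rho_formula_eq: "rho_formula lam \<kappa> u0 \<rho>0 x y = R x y"
  by (simp add: rho_formula_def P0_bar_eq R_def E_def)

lemma continuous_on_formulas:
  assumes "S \<subseteq> D"
  shows "continuous_on S (ux_formula lam \<kappa> u0 \<rho>0 x)" "continuous_on S (rho_formula lam \<kappa> u0 \<rho>0 x)"
proof -
  have "continuous_on S (\<lambda>y. V x y)"
    by (rule continuous_on_compose_pair[OF continuous_on_VR(1)]) (use assms in \<open>auto intro!: continuous_intros\<close>)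
  then show "continuous_on S (ux_formula lam \<kappa> u0 \<rho>0 x)"
    by (rule continuous_on_eq) (rule ux_formula_eq[symmetric], use assms in blast)
  have "continuous_on S (\<lambda>y. R x y)"
    by (rule continuous_on_compose_pair[OF continuous_on_VR(4)]) (use assms in \<open>auto intro!: continuous_intros\<close>)
  then show "continuous_on S (rho_formula lam \<kappa> u0 \<rho>0 x)"
    by (rule continuous_on_eq) (rule rho_formula_eq[symmetric])
qed

text \<open>
  The discriminant \<open>Q\<^sub>\<eta>\<^sup>2 - 2 Q Q\<^sub>\<eta>\<^sub>\<eta>\<close> of the quadratic \<open>Q\<close> is constant in \<open>\<eta>\<close>; here it is divided by \<open>Q\<^sup>2\<close>.  It is what ties the exponent \<open>p\<close> to the
  coupling constant \<open>\<kappa>\<close>.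
\<close>

lemma discriminant:
  assumes y: "y \<in> D"
  shows "\<kappa> * (\<rho>0 x / QQ x y)\<^sup>2 = p * (Qyy x / QQ x y - (Qy x y / QQ x y)\<^sup>2 / 2)"
proof -
  have "(Qy x y)\<^sup>2 - 2 * QQ x y * Qyy x = 4 * lam * \<kappa> * (\<rho>0 x)\<^sup>2"
    unfolding Qy_def Qyy_def Q_eq C_eq by (simp add: power2_eq_square algebra_simps)
  then have "p * ((Qy x y)\<^sup>2 - 2 * QQ x y * Qyy x) = - 2 * \<kappa> * (\<rho>0 x)\<^sup>2"
    using lam_nz by (simp add: p_def)
  then show ?thesis using Q_pos[OF y, of x] by (simp add: field_simps power2_eq_square)
qed

text \<open>
  The nonlocal term of the system as a function of \<open>\<eta>\<close>; see \<open>nonlocal_identity\<close>.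
\<close>

definition "J y = (E y)\<^sup>2 * ((1 + lam) * (P1 y / P y)\<^sup>2 - P2 y / P y)"

text \<open>
  With \<open>X = Q\<^sub>\<eta>/Q\<close> and \<open>Y = Q\<^sub>\<eta>\<^sub>\<eta>/Q\<close> the left side is a polynomial in \<open>X\<close>, \<open>Y\<close> and \<open>P\<close>-terms.  The mixed term in
  \<open>X\<close> and \<open>P1/P\<close> cancels, the \<open>X\<^sup>2\<close> and \<open>Y\<close> terms cancel against \<open>\<kappa>\<rho>\<^sup>2\<close> by \<open>discriminant\<close>, all because
  \<open>p \<lambda> = -1/2\<close>; what is left does not depend on the label.
\<close>

lemma V_equation:
  assumes y: "y \<in> D"
  shows "Vy x y * E y - lam * (V x y)\<^sup>2 - \<kappa> * (R x y)\<^sup>2 = J y"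
proof -
  define X Y Z T where "X = Qy x y / QQ x y" and "Y = Qyy x / QQ x y"
    and "Z = P1 y / P y" and "T = P2 y / P y"
  have pl: "p * lam = - 1 / 2" by (rule p_lam)
  have "\<kappa> * (R x y)\<^sup>2 = (E y)\<^sup>2 * (\<kappa> * (\<rho>0 x / QQ x y)\<^sup>2)"
    unfolding R_def power_mult_distrib by simp
  then have 1: "\<kappa> * (R x y)\<^sup>2 = (E y)\<^sup>2 * (p * (Y - X\<^sup>2 / 2))"
    unfolding discriminant[OF y] X_def Y_def .
  have 2: "E1 y = - 2 * lam * E y * Z" by (simp add: E1_def Z_def)
  have "- 2 * lam * Z * (p * X - Z) + (p * (Y - X\<^sup>2) - (T - Z\<^sup>2)) - lam * (p * X - Z)\<^sup>2
       - p * (Y - X\<^sup>2 / 2)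
     = (1 + lam) * Z\<^sup>2 - T - p * (p * lam + 1 / 2) * X\<^sup>2"
    by (simp add: power2_eq_square field_simps)
  also have "\<dots> = (1 + lam) * Z\<^sup>2 - T" by (simp add: pl)
  finally have 3: "- 2 * lam * Z * (p * X - Z) + (p * (Y - X\<^sup>2) - (T - Z\<^sup>2)) - lam * (p * X - Z)\<^sup>2
       - p * (Y - X\<^sup>2 / 2) = (1 + lam) * Z\<^sup>2 - T" .
  have "Vy x y * E y - lam * (V x y)\<^sup>2 - \<kappa> * (R x y)\<^sup>2 =
    (E y)\<^sup>2 * (- 2 * lam * Z * (p * X - Z) + (p * (Y - X\<^sup>2) - (T - Z\<^sup>2)) - lam * (p * X - Z)\<^sup>2
       - p * (Y - X\<^sup>2 / 2))"
    unfolding 1 Vy_def V_def W_def Wy_def 2 X_def[symmetric] Y_def[symmetric] Z_def[symmetric]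
      T_def[symmetric] by (simp add: power2_eq_square algebra_simps)
  also have "\<dots> = J y" unfolding 3 unfolding J_def Z_def T_def ..
  finally show ?thesis .
qed

lemma R_equation:
  assumes y: "y \<in> D"
  shows "Ry x y * E y = 2 * lam * R x y * V x y"
proof -
  define X S Z where "X = Qy x y / QQ x y" and "S = \<rho>0 x / QQ x y" and "Z = P1 y / P y"
  have 1: "E1 y = - 2 * lam * E y * Z" by (simp add: E1_def Z_def)
  have 2: "\<rho>0 x * Qy x y / (QQ x y)\<^sup>2 = S * X" by (simp add: S_def X_def power2_eq_square)
  have "Ry x y * E y = (E y)\<^sup>2 * S * (- 2 * lam * Z - X)"
    unfolding Ry_def 1 2 S_def[symmetric] by (simp add: power2_eq_square algebra_simps)
  also have "- 2 * lam * Z - X = 2 * (p * lam) * X - 2 * lam * Z" by (simp add: p_lam)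
  also have "(E y)\<^sup>2 * S * \<dots> = 2 * lam * R x y * V x y"
    unfolding R_def V_def W_def S_def[symmetric] X_def[symmetric] Z_def[symmetric]
    by (simp add: power2_eq_square algebra_simps)
  finally show ?thesis .
qed

text \<open>
  Substitution \<open>x = G \<alpha> y\<close>, done by differentiating a primitive of \<open>f g\<close> composed with \<open>H\<close>.
\<close>

lemma integral_H:
  assumes y: "y \<in> D" and f: "continuous_on UNIV f"
  shows "integral {0..1} (\<lambda>x. f (H x y)) = integral {0..1} (\<lambda>x. f x * g x y)"
proof -
  define \<Psi> where "\<Psi> = prim (\<lambda>x. f x * g x y)"
  have \<Psi>: "(\<Psi> has_real_derivative f x * g x y) (at x)" for x
    unfolding \<Psi>_def
    by (intro DERIV_prim continuous_intros f continuous_on_slice[OF continuous_on_G(3) y])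
  have "((\<lambda>x. f (H x y)) has_integral (\<Psi> (H 1 y) - \<Psi> (H 0 y))) {0..1}"
  proof (rule fundamental_theorem_of_calculus)
    fix x :: real
    have "((\<lambda>x. \<Psi> (H x y)) has_real_derivative f (H x y) * g (H x y) y * (1 / g (H x y) y)) (at x)"
      by (rule DERIV_chain2[OF \<Psi> DERIV_H_x[OF y]])
    then have "((\<lambda>x. \<Psi> (H x y)) has_real_derivative f (H x y)) (at x)"
      using g_pos[OF y, of "H x y"] by simp
    then show "((\<lambda>x. \<Psi> (H x y)) has_vector_derivative f (H x y)) (at x within {0..1})"
      by (simp add: has_real_derivative_iff_has_vector_derivative has_vector_derivative_at_within)
  qed simp
  then show ?thesis by (simp add: integral_unique H_0[OF y] H_1[OF y] \<Psi>_def prim_1)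
qed

text \<open>
  After substituting labels for positions, \<open>discriminant\<close> expresses the integrand through
  \<open>q\<close>, \<open>q1\<close> and \<open>q2\<close>, whose means over a period are \<open>P\<close>, \<open>P1\<close> and \<open>P2\<close>.
\<close>

lemma nonlocal_identity:
  assumes y: "y \<in> D"
  shows "- \<kappa> * integral {0..1} (\<lambda>x. (R (H x y) y)\<^sup>2)
       - (1 + lam) * integral {0..1} (\<lambda>x. (V (H x y) y)\<^sup>2) = J y"
proof -
  have c: "continuous_on S (\<lambda>x. V x y)" "continuous_on S (\<lambda>x. R x y)" "continuous_on S (\<lambda>x. g x y)"
    "continuous_on S (\<lambda>x. q x y)" "continuous_on S (\<lambda>x. q1 x y)" "continuous_on S (\<lambda>x. q2 x y)" for S
    by (intro continuous_on_slice[OF continuous_on_VR(1) y] continuous_on_slice[OF continuous_on_VR(4) y]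
      continuous_on_slice[OF continuous_on_G(3) y] continuous_on_slice[OF continuous_on_q(1) y]
      continuous_on_slice[OF continuous_on_q(2) y] continuous_on_slice[OF continuous_on_q(3) y] continuous_intros)+
  define Z where "Z = P1 y / P y"
  define m where "m = (E y)\<^sup>2 / P y"
  have pw: "- \<kappa> * ((R x y)\<^sup>2 * g x y) - (1 + lam) * ((V x y)\<^sup>2 * g x y) =
      m * (- q2 x y + 2 * (1 + lam) * Z * q1 x y - (1 + lam) * Z\<^sup>2 * q x y)" for x
  proof -
    define X Y where "X = Qy x y / QQ x y" and "Y = Qyy x / QQ x y"
    have "\<kappa> * ((R x y)\<^sup>2 * g x y) = (E y)\<^sup>2 * (\<kappa> * (\<rho>0 x / QQ x y)\<^sup>2) * (q x y / P y)"
      unfolding R_def g_def power_mult_distrib by simp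
    also have "\<dots> = m * (p * (Y - X\<^sup>2 / 2)) * q x y"
      unfolding discriminant[OF y] by (simp add: X_def Y_def m_def)
    finally have 1: "\<kappa> * ((R x y)\<^sup>2 * g x y) = m * (p * (Y - X\<^sup>2 / 2)) * q x y" .
    have 2: "(V x y)\<^sup>2 * g x y = m * (p * X - Z)\<^sup>2 * q x y"
      unfolding V_def W_def g_def X_def Z_def m_def power_mult_distrib by simp
    have 3: "q1 x y = p * X * q x y" "q2 x y = (p * (p - 1) * X\<^sup>2 + p * Y) * q x y"
      using y by (simp_all add: q1_eq q2_eq X_def Y_def)
    have "- (m * (p * (Y - X\<^sup>2 / 2)) * q x y) - (1 + lam) * (m * (p * X - Z)\<^sup>2 * q x y)
      = m * (- ((p * (p - 1) * X\<^sup>2 + p * Y) * q x y) + 2 * (1 + lam) * Z * (p * X * q x y) - (1 + lam) * Z\<^sup>2 * q x y)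
        - m * q x y * p * (p * lam + 1 / 2) * X\<^sup>2"
      by (simp add: power2_eq_square field_simps)
    then show ?thesis unfolding mult_minus_left 1 2 3 p_lam by simp
  qed
  have "- \<kappa> * integral {0..1} (\<lambda>x. (R (H x y) y)\<^sup>2)
       - (1 + lam) * integral {0..1} (\<lambda>x. (V (H x y) y)\<^sup>2)
      = - \<kappa> * integral {0..1} (\<lambda>x. (R x y)\<^sup>2 * g x y) - (1 + lam) * integral {0..1} (\<lambda>x. (V x y)\<^sup>2 * g x y)"
    by (subst (1 2) integral_H[OF y]) (auto intro!: continuous_intros c)
  also have "\<dots> = integral {0..1} (\<lambda>x. - \<kappa> * ((R x y)\<^sup>2 * g x y) - (1 + lam) * ((V x y)\<^sup>2 * g x y))"
    by (subst integral_diff) (auto intro!: integrable_continuous_real continuous_intros c)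
  also have "\<dots> = m * (- P2 y + 2 * (1 + lam) * Z * P1 y - (1 + lam) * Z\<^sup>2 * P y)"
  proof -
    have "((\<lambda>x. m * (- q2 x y + 2 * (1 + lam) * Z * q1 x y - (1 + lam) * Z\<^sup>2 * q x y)) has_integral
       m * (- P2 y + 2 * (1 + lam) * Z * P1 y - (1 + lam) * Z\<^sup>2 * P y)) {0..1}"
      unfolding P_def P1_def P2_def F_def F1_def prim_1
      by (intro has_integral_mult_right has_integral_add has_integral_diff has_integral_neg
          integrable_integral integrable_continuous_real c)
    then show ?thesis unfolding pw by (rule integral_unique)
  qed
  also have "\<dots> = J y"
    using P_pos[OF y] by (simp add: m_def J_def Z_def field_simps power2_eq_square)
  finally show ?thesis .
qed

end

section \<open>Existence of a classical solution\<close>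

locale odd_flow = odd_data +
  fixes T :: real and \<eta> :: "real \<Rightarrow> real"
  assumes eta: "is_eta lam \<kappa> u0 \<rho>0 T \<eta>"
    and eta_D: "\<And>t. t \<in> {0..<T} \<Longrightarrow> \<eta> t \<in> D"
begin

lemma eta_0: "\<eta> 0 = 0"
  using eta by (simp add: is_eta_def)

lemma DERIV_eta_within: "t \<in> {0..<T} \<Longrightarrow> (\<eta> has_real_derivative E (\<eta> t)) (at t within {0..<T})"
  using eta by (simp add: is_eta_def P0_bar_eq E_def)

lemma DERIV_eta: assumes t: "t \<in> {0<..<T}" shows "(\<eta> has_real_derivative E (\<eta> t)) (at t)"
proof -
  have "at t within {0..<T} = at t"
    using t by (intro at_within_open_subset[of t "{0<..<T}"]) auto
  then show ?thesis using DERIV_eta_within[of t] t by simp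
qed

lemma continuous_on_eta [continuous_intros]:
  assumes "continuous_on S f" "\<And>z. z \<in> S \<Longrightarrow> f z \<in> {0..<T}"
  shows "continuous_on S (\<lambda>z. \<eta> (f z))"
proof (rule continuous_on_compose2[OF _ assms(1)])
  show "continuous_on {0..<T} \<eta>" by (rule DERIV_continuous_on) (rule DERIV_eta_within)
qed (use assms(2) in auto)

lemma continuous_on_transported:
  assumes "continuous_on (UNIV \<times> D) (\<lambda>(x, y). \<Phi> x y)" and S: "S \<subseteq> {0..<T}"
  shows "continuous_on (UNIV \<times> S) (\<lambda>(x, t). \<Phi> (H x (\<eta> t)) (\<eta> t))"
  unfolding case_prod_unfold
  by (intro continuous_on_compose_pair[OF assms(1)] continuous_on_compose_pair[OF continuous_on_H]
      continuous_intros) (use S eta_D in auto)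

text \<open>
  The velocity is the time derivative of the position \<open>G \<alpha> (\<eta> t)\<close>, evaluated at the label \<open>\<alpha> = H x (\<eta> t)\<close>.
\<close>

definition "u x t = E (\<eta> t) * G1 (H x (\<eta> t)) (\<eta> t)"

text \<open>
  For a function of label and \<open>\<eta>\<close>, read as a function \<open>f\<close> of position and time, the material derivative
  \<open>f\<^sub>t + u f\<^sub>x\<close> is the \<open>\<eta>\<close>-derivative times \<open>d\<eta>/dt\<close>.  The derivatives of \<open>H\<close> contribute
  \<open>-G1/g\<close> in \<open>f\<^sub>t\<close> and \<open>1/g\<close> in \<open>f\<^sub>x\<close>, and \<open>u = E G1\<close> makes them cancel.  It is applied to \<open>u\<^sub>x\<close> and to \<open>\<rho>\<close>.
\<close>

lemma transported:
  fixes \<Phi> \<Phi>x \<Phi>y f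
  assumes dx: "\<And>x y. y \<in> D \<Longrightarrow> ((\<lambda>x. \<Phi> x y) has_real_derivative \<Phi>x x y) (at x)"
    and dy: "\<And>x y. y \<in> D \<Longrightarrow> ((\<lambda>y. \<Phi> x y) has_real_derivative \<Phi>y x y) (at y)"
    and cx: "continuous_on (UNIV \<times> D) (\<lambda>(x, y). \<Phi>x x y)"
    and cy: "continuous_on (UNIV \<times> D) (\<lambda>(x, y). \<Phi>y x y)"
    and f: "\<And>x t. t \<in> {0..<T} \<Longrightarrow> f x t = \<Phi> (H x (\<eta> t)) (\<eta> t)"
  shows "C1_on_strip T f"
    and "\<And>x t. t \<in> {0<..<T} \<Longrightarrow> D_t f x t + u x t * D_x f x t = \<Phi>y (H x (\<eta> t)) (\<eta> t) * E (\<eta> t)"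
proof -
  define fx where "fx = (\<lambda>x y. \<Phi>x x y / g x y)"
  define ft where "ft = (\<lambda>x y. (\<Phi>y x y - fx x y * G1 x y) * E y)"
  have Dx: "((\<lambda>x. f x t) has_real_derivative fx (H x (\<eta> t)) (\<eta> t)) (at x)" if t: "t \<in> {0<..<T}" for x t
  proof -
    have D: "\<eta> t \<in> D" using t eta_D by simp
    have "((\<lambda>x. \<Phi> (H x (\<eta> t)) (\<eta> t)) has_real_derivative
        \<Phi>x (H x (\<eta> t)) (\<eta> t) * (1 / g (H x (\<eta> t)) (\<eta> t))) (at x)"
      by (rule DERIV_chain2[OF dx[OF D] DERIV_H_x[OF D]])
    then show ?thesis using f t by (simp add: fx_def)
  qed
  have Dt: "((\<lambda>t. f x t) has_real_derivative ft (H x (\<eta> t)) (\<eta> t)) (at t)" if t: "t \<in> {0<..<T}" for x t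
  proof -
    have D: "\<eta> t \<in> D" using t eta_D by simp
    have h: "((\<lambda>t. H x (\<eta> t)) has_real_derivative
        - G1 (H x (\<eta> t)) (\<eta> t) / g (H x (\<eta> t)) (\<eta> t) * E (\<eta> t)) (at t)"
      by (rule DERIV_chain2[OF DERIV_H_y[OF D] DERIV_eta[OF t]])
    have "((\<lambda>t. \<Phi> (H x (\<eta> t)) (\<eta> t)) has_real_derivative
        - G1 (H x (\<eta> t)) (\<eta> t) / g (H x (\<eta> t)) (\<eta> t) * E (\<eta> t) * \<Phi>x (H x (\<eta> t)) (\<eta> t)
        + \<Phi>y (H x (\<eta> t)) (\<eta> t) * E (\<eta> t)) (at t)"
      by (rule DERIV_chain_partials[where D=D and h="\<lambda>t. H x (\<eta> t)" and y=\<eta> and ?\<Phi>1.0=\<Phi>x,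
            OF _ D dx cx dy[OF D] h DERIV_eta[OF t]]) auto
    then have "((\<lambda>t. \<Phi> (H x (\<eta> t)) (\<eta> t)) has_real_derivative ft (H x (\<eta> t)) (\<eta> t)) (at t)"
      by (rule DERIV_cong) (simp add: ft_def fx_def algebra_simps)
    then show ?thesis
      by (rule has_field_derivative_transform_within_open[where S="{0<..<T}"]) (use t f in auto)
  qed
  have eqx: "D_x f x t = fx (H x (\<eta> t)) (\<eta> t)" if "t \<in> {0<..<T}" for x t
    unfolding D_x_def by (rule DERIV_imp_deriv[OF Dx[OF that]])
  have eqt: "D_t f x t = ft (H x (\<eta> t)) (\<eta> t)" if "t \<in> {0<..<T}" for x t
    unfolding D_t_def by (rule DERIV_imp_deriv[OF Dt[OF that]])
  have nz: "g (fst z) (snd z) \<noteq> 0" "snd z \<in> D" if "z \<in> UNIV \<times> D" for z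
    using g_pos[of "snd z" "fst z"] that by auto
  have cfx: "continuous_on (UNIV \<times> D) (\<lambda>(x, y). fx x y)"
    unfolding fx_def case_prod_unfold
    by (intro continuous_intros cx[unfolded case_prod_unfold] continuous_on_G(3)[unfolded case_prod_unfold]
        ballI nz)
  have cft: "continuous_on (UNIV \<times> D) (\<lambda>(x, y). ft x y)"
    unfolding ft_def case_prod_unfold
    by (intro continuous_intros cy[unfolded case_prod_unfold] cfx[unfolded case_prod_unfold]
        continuous_on_G(2)[unfolded case_prod_unfold] nz)
  show "C1_on_strip T f"
    unfolding C1_on_strip_def
  proof (intro conjI allI ballI)
    fix x t assume t: "t \<in> {0<..<T}"
    show "(\<lambda>y. f y t) differentiable at x" "(\<lambda>s. f x s) differentiable at t"
      using Dx[OF t] Dt[OF t] by (auto simp: real_differentiable_def)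
  next
    have "continuous_on (UNIV \<times> {0<..<T}) (\<lambda>(x, t). fx (H x (\<eta> t)) (\<eta> t))"
      by (rule continuous_on_transported[OF cfx]) auto
    then show "continuous_on (UNIV \<times> {0<..<T}) (\<lambda>(x, t). D_x f x t)"
      by (rule continuous_on_eq) (auto simp: eqx)
    have "continuous_on (UNIV \<times> {0<..<T}) (\<lambda>(x, t). ft (H x (\<eta> t)) (\<eta> t))"
      by (rule continuous_on_transported[OF cft]) auto
    then show "continuous_on (UNIV \<times> {0<..<T}) (\<lambda>(x, t). D_t f x t)"
      by (rule continuous_on_eq) (auto simp: eqt)
  qed
  show "D_t f x t + u x t * D_x f x t = \<Phi>y (H x (\<eta> t)) (\<eta> t) * E (\<eta> t)"
    if t: "t \<in> {0<..<T}" for x t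
    by (simp add: eqx[OF t] eqt[OF t] u_def ft_def algebra_simps)
qed

definition "\<rho> x t = R (H x (\<eta> t)) (\<eta> t)"
definition "\<gamma> \<alpha> t = G \<alpha> (\<eta> t)"

lemma DERIV_u_x:
  assumes t: "t \<in> {0..<T}"
  shows "((\<lambda>x. u x t) has_real_derivative V (H x (\<eta> t)) (\<eta> t)) (at x)"
proof -
  have D: "\<eta> t \<in> D" using t eta_D by simp
  have "((\<lambda>x. u x t) has_real_derivative
     E (\<eta> t) * (g (H x (\<eta> t)) (\<eta> t) * W (H x (\<eta> t)) (\<eta> t) * (1 / g (H x (\<eta> t)) (\<eta> t)))) (at x)"
    unfolding u_def by (rule DERIV_cmult, rule DERIV_chain2[OF DERIV_G1_x[OF D] DERIV_H_x[OF D]])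
  then show ?thesis using g_pos[OF D, of "H x (\<eta> t)"] by (simp add: V_def)
qed

lemma D_x_u: "t \<in> {0..<T} \<Longrightarrow> D_x u x t = V (H x (\<eta> t)) (\<eta> t)"
  unfolding D_x_def by (rule DERIV_imp_deriv[OF DERIV_u_x])

text \<open>
  At \<open>\<eta> = 0\<close> we have \<open>Q = 1\<close> and \<open>p Q\<^sub>\<eta> = u0'\<close>.  Hence the flow starts at the identity and its
  initial velocity is the primitive of \<open>u0'\<close> vanishing at 0, which is \<open>u0\<close> because \<open>u0\<close> is odd.
\<close>

lemma G_at_0: "G x 0 = x" and G1_at_0: "G1 x 0 = u0 x" and E_at_0: "E 0 = 1" and R_at_0: "R x 0 = \<rho>0 x"
proof -
  have Q0: "QQ x 0 = 1" for x by (simp add: Q_eq)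
  have q0: "q x 0 = 1" and q10: "q1 x 0 = v x" for x
    using lam_nz by (simp_all add: q_def q1_def Q0 Qy_def p_def)
  have F0: "F x 0 = x" for x by (simp add: F_def q0 prim_def)
  then have P0: "P 0 = 1" by (simp add: P_def)
  have u00: "u0 0 = 0" using u0_odd[of 0] by simp
  have F10: "F1 x 0 = u0 x" for x
    unfolding F1_def q10 using prim_eq_diff[of u0 v x] DERIV_u0 u00 by simp
  have "P1 0 = 0" unfolding P1_def F10 using u0_add_1[of 0] u00 by simp
  then show "G x 0 = x" "G1 x 0 = u0 x" "E 0 = 1" "R x 0 = \<rho>0 x"
    by (simp_all add: G_def G1_def E_def R_def P0 F0 F10 Q0)
qed

lemma classical_solution: "classical_solution lam \<kappa> u0 \<rho>0 T u \<rho>"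
  unfolding classical_solution_def
proof (intro conjI ballI allI)
  fix t assume t: "t \<in> {0..<T}"
  have D: "\<eta> t \<in> D" using t eta_D by simp
  have per: "u (x + 1) t = u x t" for x by (simp add: u_def H_add_1[OF D] G_add_1[OF D])
  then show "periodic1 (\<lambda>x. u x t)" by (simp add: periodic1_def)
  show "periodic1 (\<lambda>x. \<rho> x t)"
    by (simp add: periodic1_def \<rho>_def H_add_1[OF D] R_def Q_add_1 \<rho>0_add_1)
  show "integral {0..1} (\<lambda>x. u x t) = 0"
    by (rule integral_odd_periodic) (simp_all add: per, simp add: u_def H_odd[OF D] G_odd)
  show "(\<lambda>y. u y t) differentiable at x" for x
    using DERIV_u_x[OF t] by (auto simp: real_differentiable_def)
next
  have "continuous_on (UNIV \<times> D) (\<lambda>(x, y). E y * G1 x y)"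
    unfolding case_prod_unfold
    by (intro continuous_intros continuous_on_G(2)[unfolded case_prod_unfold]) auto
  from continuous_on_transported[OF this subset_refl]
  show "continuous_on (UNIV \<times> {0..<T}) (\<lambda>(x, t). u x t)" by (simp add: u_def)
  show "continuous_on (UNIV \<times> {0..<T}) (\<lambda>(x, t). D_x u x t)"
    by (rule continuous_on_eq[OF continuous_on_transported[OF continuous_on_VR(1) subset_refl]])
       (auto simp: D_x_u)
  show "continuous_on (UNIV \<times> {0..<T}) (\<lambda>(x, t). \<rho> x t)"
    using continuous_on_transported[OF continuous_on_VR(4) subset_refl] by (simp add: \<rho>_def)
  note V = transported[where f="D_x u" and \<Phi>=V, OF DERIV_V_x DERIV_V_y continuous_on_VR(2,3) D_x_u]
  note R = transported[where f=\<rho> and \<Phi>=R, OF DERIV_R_x DERIV_R_y continuous_on_VR(5,6) \<rho>_def]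
  show "C1_on_strip T (D_x u)" "C1_on_strip T \<rho>" using V(1) R(1) by auto
  fix x
  have D0: "0 \<in> D" using el eh by simp
  have "H x 0 = x" by (rule H_eqI[OF D0 G_at_0])
  then show "u x 0 = u0 x" "\<rho> x 0 = \<rho>0 x"
    by (simp_all add: u_def \<rho>_def eta_0 G1_at_0 E_at_0 R_at_0)
  fix t assume t: "t \<in> {0<..<T}"
  then have t': "t \<in> {0..<T}" and D: "\<eta> t \<in> D" using eta_D by auto
  have "nonlocal_I lam \<kappa> u \<rho> t = J (\<eta> t)"
    unfolding nonlocal_I_def using nonlocal_identity[OF D] by (simp add: D_x_u[OF t'] \<rho>_def)
  moreover have "D_t (D_x u) x t + u x t * D_x (D_x u) x t = Vy (H x (\<eta> t)) (\<eta> t) * E (\<eta> t)"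
    using V(2) t by blast
  ultimately show "D_t (D_x u) x t + u x t * D_x (D_x u) x t - lam * (D_x u x t)\<^sup>2 - \<kappa> * (\<rho> x t)\<^sup>2
          = nonlocal_I lam \<kappa> u \<rho> t"
    using V_equation[OF D, of "H x (\<eta> t)"] by (simp add: D_x_u[OF t'] \<rho>_def)
  have "D_t \<rho> x t + u x t * D_x \<rho> x t = Ry (H x (\<eta> t)) (\<eta> t) * E (\<eta> t)"
    using R(2) t by blast
  then show "D_t \<rho> x t + u x t * D_x \<rho> x t = 2 * lam * \<rho> x t * D_x u x t"
    unfolding R_equation[OF D] by (simp add: D_x_u[OF t'] \<rho>_def)
qed

lemma represented_solution: "represented_solution lam \<kappa> u0 \<rho>0 \<eta> T u \<rho> \<gamma>"
  unfolding represented_solution_def characteristics_def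
proof (intro conjI classical_solution ballI)
  fix \<alpha> :: real
  show "\<gamma> \<alpha> 0 = \<alpha>" by (simp add: \<gamma>_def eta_0 G_at_0)
  fix t assume t: "t \<in> {0..<T}"
  then have D: "\<eta> t \<in> D" using eta_D by auto
  have H: "H (\<gamma> \<alpha> t) (\<eta> t) = \<alpha>" by (simp add: \<gamma>_def H_G[OF D])
  have "((\<lambda>t. G \<alpha> (\<eta> t)) has_real_derivative G1 \<alpha> (\<eta> t) * E (\<eta> t)) (at t within {0..<T})"
    by (rule DERIV_chain2[OF DERIV_G_y[OF D] DERIV_eta_within[OF t]])
  then show "(\<gamma> \<alpha> has_real_derivative u (\<gamma> \<alpha> t) t) (at t within {0..<T})"
    unfolding u_def H by (simp add: \<gamma>_def[abs_def] mult.commute)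
  show "D_x u (\<gamma> \<alpha> t) t = ux_formula lam \<kappa> u0 \<rho>0 \<alpha> (\<eta> t)"
    by (simp add: D_x_u[OF t] H ux_formula_eq[OF D])
  show "\<rho> (\<gamma> \<alpha> t) t = rho_formula lam \<kappa> u0 \<rho>0 \<alpha> (\<eta> t)"
    by (simp add: \<rho>_def H rho_formula_eq)
qed

end

section \<open>Estimates for cosine, powers and half-open intervals\<close>

lemma deriv_funpow_sin:
  "(deriv ^^ n) (\<lambda>x::real. a * sin (w * x)) = (\<lambda>x. a * w ^ n * sin (w * x + n * (pi / 2)))"
proof (induction n)
  case (Suc n)
  have "((\<lambda>x. a * w ^ n * sin (w * x + n * (pi / 2))) has_real_derivative
      a * w ^ Suc n * sin (w * x + Suc n * (pi / 2))) (at x)" for x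
  proof -
    have "sin (w * x + Suc n * (pi / 2)) = cos (w * x + n * (pi / 2))"
      using sin_add[of "w * x + n * (pi / 2)" "pi / 2"] by (simp add: algebra_simps add_divide_distrib)
    then show ?thesis by (auto intro!: derivative_eq_intros)
  qed
  then show ?case using Suc by (auto simp: DERIV_imp_deriv)
qed simp

lemma smooth_sin: "smooth (\<lambda>x. a * sin (w * x))"
proof -
  have "((\<lambda>x. k * sin (w * x + b)) has_real_derivative k * (cos (w * x + b) * w)) (at x)" for k b x
    by (auto intro!: derivative_eq_intros)
  then show ?thesis unfolding smooth_def deriv_funpow_sin real_differentiable_def by blast
qed

lemma smooth_const: "smooth (\<lambda>x. a)"
proof -
  have "(deriv ^^ n) (\<lambda>x::real. a) = (if n = 0 then (\<lambda>x. a) else (\<lambda>x. 0))" for n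
    by (induction n) auto
  then show ?thesis by (simp add: smooth_def)
qed

lemma finite_cos_eq: "finite {x \<in> {0..1}. cos (2 * pi * x) = r}"
proof -
  have inj: "inj_on (\<lambda>x. cos (2 * pi * x)) {0..1/2}"
  proof (rule inj_onI)
    fix x y :: real
    assume xy: "x \<in> {0..1/2}" "y \<in> {0..1/2}" and eq: "cos (2 * pi * x) = cos (2 * pi * y)"
    have le: "2 * pi * z \<le> pi" if "z \<in> {0..1/2}" for z
      using mult_left_mono[of z "1/2" "2 * pi"] that by simp
    have "2 * pi * x = 2 * pi * y" by (rule cos_inj_pi[OF _ _ _ _ eq]) (use xy in \<open>simp_all add: le\<close>)
    then show "x = y" by simp
  qed
  let ?A = "(\<lambda>x. cos (2 * pi * x)) -` {r} \<inter> {0..1/2}"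
  have fin: "finite ?A" by (rule finite_vimage_IntI[OF _ inj]) simp
  have "{x \<in> {0..1}. cos (2 * pi * x) = r} \<subseteq> ?A \<union> (\<lambda>x. 1 - x) ` ?A"
  proof
    fix x assume x: "x \<in> {x \<in> {0..1}. cos (2 * pi * x) = r}"
    show "x \<in> ?A \<union> (\<lambda>x. 1 - x) ` ?A"
    proof (cases "x \<le> 1/2")
      case False
      have "cos (2 * pi * (1 - x)) = cos (2 * pi * x)" by (simp add: algebra_simps cos_diff)
      then have "1 - x \<in> ?A" using x False by simp
      then have "1 - (1 - x) \<in> (\<lambda>x. 1 - x) ` ?A" by (rule imageI)
      then show ?thesis by simp
    qed (use x in simp)
  qed
  then show ?thesis using fin by (blast intro: finite_subset)
qed

lemma cos_2pi_eq_1_iff: "x \<in> {0..1} \<Longrightarrow> cos (2 * pi * x) = 1 \<longleftrightarrow> x \<in> {0, 1}"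
proof
  assume x: "x \<in> {0..1}" and "cos (2 * pi * x) = 1"
  then obtain n :: int where "2 * pi * x = of_int n * 2 * pi" unfolding cos_one_2pi_int by blast
  then have n: "x = of_int n" by simp
  then have "0 \<le> n" "n \<le> 1" using x by auto
  then have "n = 0 \<or> n = 1" by linarith
  then show "x \<in> {0, 1}" using n by auto
qed auto

lemma one_minus_cos_le: "1 - cos (2 * pi * x) \<le> 32 * x\<^sup>2"
proof -
  have "1 - cos (2 * pi * x) = 2 * (sin (pi * x))\<^sup>2"
    using cos_double_sin[of "pi * x"] by (simp add: mult.assoc)
  also have "(sin (pi * x))\<^sup>2 \<le> (pi * x)\<^sup>2"
    using abs_sin_x_le_abs_x[of "pi * x"] by (simp add: abs_le_square_iff)
  also have "(pi * x)\<^sup>2 \<le> (4 * x)\<^sup>2"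
    unfolding power_mult_distrib using pi_less_4 by (intro mult_right_mono power_mono) auto
  finally show ?thesis by (simp add: power_mult_distrib)
qed

lemma le_sin_pi: assumes "x \<in> {0..1/2}" shows "x \<le> sin (pi * x)"
proof (cases "x \<le> 1/3")
  case True
  have "sin 0 - 0 / 2 \<le> sin (pi * x) - pi * x / 2"
  proof (rule DERIV_nonneg_imp_nondecreasing[where f="\<lambda>z. sin z - z / 2"])
    show "0 \<le> pi * x" using assms by simp
    fix z assume z: "0 \<le> z" "z \<le> pi * x"
    have "pi * x \<le> pi * (1/3)" using True by (intro mult_left_mono) auto
    then have "cos (pi / 3) \<le> cos z" using z pi_gt_zero by (intro cos_monotone_0_pi_le) linarith+
    then show "\<exists>d. ((\<lambda>z. sin z - z / 2) has_real_derivative d) (at z) \<and> 0 \<le> d"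
      by (intro exI[of _ "cos z - 1/2"]) (auto intro!: derivative_eq_intros simp: cos_60)
  qed
  moreover have "2 * x \<le> pi * x" using assms pi_ge_two by (intro mult_right_mono) auto
  ultimately show ?thesis by simp
next
  case False
  have "sin (pi / 6) \<le> sin (pi * x)"
  proof (rule sin_monotone_2pi_le)
    show "- (pi / 2) \<le> pi / 6" by simp
    have "pi * (1 / 6) \<le> pi * x" using False by (intro mult_left_mono) auto
    then show "pi / 6 \<le> pi * x" by simp
    have "pi * x \<le> pi * (1 / 2)" using assms by (intro mult_left_mono) auto
    then show "pi * x \<le> pi / 2" by simp
  qed
  then show ?thesis using assms by (simp add: sin_30)
qed

text \<open>
  The maximum of the cosine is nondegenerate.  This is the lower half of \<open>Q \<approx> (1 - \<eta>) + \<alpha>\<^sup>2\<close>;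
  \<open>one_minus_cos_le\<close> is the upper half.
\<close>

lemma one_minus_cos_ge:
  assumes "x \<in> {0..1}"
  shows "2 * (min x (1 - x))\<^sup>2 \<le> 1 - cos (2 * pi * x)"
proof -
  have *: "2 * z\<^sup>2 \<le> 1 - cos (2 * pi * z)" if "z \<in> {0..1/2}" for z
  proof -
    have "z\<^sup>2 \<le> (sin (pi * z))\<^sup>2" using le_sin_pi[OF that] that by (intro power_mono) auto
    then show ?thesis using cos_double_sin[of "pi * z"] by (simp add: mult.assoc)
  qed
  show ?thesis
  proof (cases "x \<le> 1/2")
    case True then show ?thesis using *[of x] assms by (simp add: min_def)
  next
    case False
    have "cos (2 * pi * (1 - x)) = cos (2 * pi * x)" by (simp add: algebra_simps cos_diff)
    then show ?thesis using *[of "1 - x"] assms False by (simp add: min_def)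
  qed
qed

text \<open>
  A power is monotone in its base, increasing or decreasing with the sign of \<open>s\<close>; the sum covers both
  cases, so that negative and positive \<open>r\<close> are treated together below.
\<close>

lemma powr_le_add:
  fixes a x b s :: real
  assumes "0 < a" "a \<le> x" "x \<le> b"
  shows "x powr s \<le> a powr s + b powr s"
proof (cases "0 \<le> s")
  case True
  then have "x powr s \<le> b powr s" using assms by (intro powr_mono2) auto
  then show ?thesis using powr_ge_zero[of a s] by linarith
next
  case False
  then have "x powr s \<le> a powr s" using assms by (intro powr_mono2') auto
  then show ?thesis using powr_ge_zero[of b s] by linarith
qed

lemma bounded_image_half_open:
  fixes f :: "real \<Rightarrow> real"
  assumes "a < b" "continuous_on {a..<b} f" "(f \<longlongrightarrow> L) (at_left b)"
  shows "bounded (f ` {a..<b})"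
proof -
  have "\<forall>\<^sub>F y in at_left b. dist (f y) L < 1" using assms(3) by (rule tendstoD) simp
  then obtain c where c: "c < b" "\<And>y. c < y \<Longrightarrow> y < b \<Longrightarrow> dist (f y) L < 1"
    by (auto simp: eventually_at_left[OF assms(1)])
  have "bounded (f ` {a..c})"
    using c(1) by (intro compact_imp_bounded compact_continuous_image continuous_on_subset[OF assms(2)]) auto
  moreover have "bounded (ball L 1)" by simp
  ultimately have "bounded (f ` {a..c} \<union> ball L 1)" by simp
  moreover have "f ` {a..<b} \<subseteq> f ` {a..c} \<union> ball L 1"
  proof
    fix z assume "z \<in> f ` {a..<b}"
    then obtain y where "a \<le> y" "y < b" "z = f y" by auto
    then show "z \<in> f ` {a..c} \<union> ball L 1"
      using c(2)[of y] by (cases "y \<le> c") (auto simp: dist_commute)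
  qed
  ultimately show ?thesis by (rule bounded_subset)
qed

section \<open>Sinusoidal initial data\<close>

locale wave =
  fixes lam \<kappa> :: real
  assumes lam: "lam < 0" and kap: "\<kappa> < 0"
begin

text \<open>
  The amplitudes are scaled so that \<open>\<lambda> u0' + \<surd>(\<lambda>\<kappa>) \<rho>0\<close> has maximum \<open>2/3 + 1/3 = 1\<close> and the first zero of
  \<open>Q\<close> is at \<open>\<eta> = 1\<close>.  The cosine has the larger amplitude, so \<open>C\<close> vanishes
  only where it equals \<open>\<plusminus>1/2\<close>, away from its maximum.
\<close>

definition "wave_u0 x = 1 / (3 * pi * lam) * sin (2 * pi * x)"
definition "wave_rho0 = (\<lambda>x::real. 1 / (3 * sqrt (lam * \<kappa>)))"

lemma lk: "0 < lam * \<kappa>" using lam kap by (simp add: mult_neg_neg)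

definition "c x = cos (2 * pi * x)"

lemma c_bounds: "-1 \<le> c x" "c x \<le> 1" by (simp_all add: c_def)

lemma DERIV_wave_u0: "(wave_u0 has_real_derivative 2 * c x / (3 * lam)) (at x)"
  unfolding wave_u0_def c_def using lam by (auto intro!: derivative_eq_intros)

lemma deriv_wave_u0: "lam * deriv wave_u0 x = 2 / 3 * c x"
  using DERIV_imp_deriv[OF DERIV_wave_u0[of x]] lam by simp

lemma wave_rho0_eq: "lam * \<kappa> * (wave_rho0 x)\<^sup>2 = 1 / 9" "sqrt (lam * \<kappa>) * \<bar>wave_rho0 x\<bar> = 1 / 3" "wave_rho0 x > 0"
  using lk lam kap by (simp_all add: wave_rho0_def power_divide power_mult_distrib)

lemma C_wave: "C_fun lam \<kappa> wave_u0 wave_rho0 x = (4 * (c x)\<^sup>2 - 1) / 9"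
proof -
  have "C_fun lam \<kappa> wave_u0 wave_rho0 x = (lam * deriv wave_u0 x)\<^sup>2 - lam * \<kappa> * (wave_rho0 x)\<^sup>2"
    by (simp add: C_fun_def power2_eq_square algebra_simps)
  then show ?thesis by (simp add: deriv_wave_u0 wave_rho0_eq power_mult_distrib power_divide)
qed

text \<open>
  The first factor carries the singularity: it is \<open>(1 - y)\<close> plus a nonnegative multiple of
  \<open>1 - cos (2 \<pi> \<alpha>)\<close>.  The second stays between positive constants for \<open>0 \<le> y \<le> 1\<close>.
\<close>

lemma Q_wave: "Q lam \<kappa> wave_u0 wave_rho0 x y
    = ((1 - y) + 2 / 3 * y * (1 - c x)) * ((1 - y / 3) + 2 / 3 * y * (1 - c x))"
proof -
  have "Q lam \<kappa> wave_u0 wave_rho0 x y = (4 * (c x)\<^sup>2 - 1) / 9 * y\<^sup>2 - 2 * (2 / 3 * c x) * y + 1"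
    unfolding Q_def C_wave deriv_wave_u0[symmetric] by simp
  then show ?thesis by (simp add: power2_eq_square field_simps)
qed

lemma Q_wave_pos: assumes "y \<in> {-1<..<1}" shows "0 < Q lam \<kappa> wave_u0 wave_rho0 x y"
proof -
  have "\<bar>y * c x\<bar> \<le> \<bar>y\<bar> * 1" unfolding abs_mult using c_bounds[of x] by (intro mult_left_mono) auto
  then have "0 < 1 - y / 3 - 2 / 3 * (y * c x)" "0 < 1 + y / 3 - 2 / 3 * (y * c x)"
    using assms by auto
  then have "0 < (1 - y / 3 - 2 / 3 * (y * c x)) * (1 + y / 3 - 2 / 3 * (y * c x))" by simp
  also have "\<dots> = Q lam \<kappa> wave_u0 wave_rho0 x y" by (simp add: Q_wave field_simps)
  finally show ?thesis .
qed

sublocale odd_data lam \<kappa> wave_u0 wave_rho0 "\<lambda>x. 2 * c x / (3 * lam)" "\<lambda>x. - 4 * pi * sin (2 * pi * x) / (3 * lam)"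
  "\<lambda>_. 0" "-1" 1
proof
  show "((\<lambda>x. 2 * c x / (3 * lam)) has_real_derivative - 4 * pi * sin (2 * pi * x) / (3 * lam)) (at x)" for x
    unfolding c_def using lam by (auto intro!: derivative_eq_intros)
  show "continuous_on UNIV (\<lambda>x. - 4 * pi * sin (2 * pi * x) / (3 * lam))"
    using lam by (intro continuous_intros) auto
  show "wave_u0 (x + 1) = wave_u0 x" "wave_u0 (- x) = - wave_u0 x" for x
    by (simp_all add: wave_u0_def algebra_simps sin_add)
qed (use lam DERIV_wave_u0 Q_wave_pos in \<open>auto simp: wave_rho0_def\<close>)

lemma admissible_wave: "admissible_data lam \<kappa> wave_u0 wave_rho0"
  unfolding admissible_data_def
proof (intro conjI)
  show "smooth wave_u0" unfolding wave_u0_def by (rule smooth_sin)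
  show "smooth wave_rho0" unfolding wave_rho0_def by (rule smooth_const)
  show "periodic1 wave_u0" "periodic1 wave_rho0" by (simp_all add: periodic1_def u0_add_1 \<rho>0_add_1)
  show "integral {0..1} wave_u0 = 0" by (rule integral_odd_periodic[OF u0_odd u0_add_1])
  show "\<exists>\<alpha>\<in>{0..1}. wave_rho0 \<alpha> \<noteq> 0" using wave_rho0_eq(3)[of 0] by (intro bexI[of _ 0]) auto
  show "\<exists>\<alpha>\<in>{0..1}. C_fun lam \<kappa> wave_u0 wave_rho0 \<alpha> \<noteq> 0"
    by (intro bexI[of _ 0]) (simp_all add: C_wave c_def)
  have "1 / 6 \<in> Omega_set lam \<kappa> wave_u0 wave_rho0"
    by (simp add: Omega_set_def C_wave c_def cos_60 power_divide)
  then show "Omega_set lam \<kappa> wave_u0 wave_rho0 \<noteq> {}" by blast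
  have "Omega_set lam \<kappa> wave_u0 wave_rho0 \<subseteq>
      {x \<in> {0..1}. cos (2 * pi * x) = 1 / 2} \<union> {x \<in> {0..1}. cos (2 * pi * x) = - 1 / 2}"
  proof
    fix x assume x: "x \<in> Omega_set lam \<kappa> wave_u0 wave_rho0"
    then have "(c x - 1 / 2) * (c x + 1 / 2) = 0"
      by (simp add: Omega_set_def C_wave power2_eq_square field_simps)
    then have "c x = 1 / 2 \<or> c x = - 1 / 2" by auto
    then show "x \<in> {x \<in> {0..1}. cos (2 * pi * x) = 1 / 2} \<union> {x \<in> {0..1}. cos (2 * pi * x) = - 1 / 2}"
      using x by (auto simp: Omega_set_def c_def)
  qed
  then show "finite (Omega_set lam \<kappa> wave_u0 wave_rho0)"
    by (rule finite_subset) (intro finite_UnI finite_cos_eq)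
qed

lemma Omega_wave: "\<alpha> \<in> Omega_set lam \<kappa> wave_u0 wave_rho0 \<Longrightarrow> c \<alpha> \<le> 1 / 2"
proof -
  assume "\<alpha> \<in> Omega_set lam \<kappa> wave_u0 wave_rho0"
  then have "(c \<alpha> - 1 / 2) * (c \<alpha> + 1 / 2) = 0"
    by (simp add: Omega_set_def C_wave power2_eq_square field_simps)
  then show ?thesis by auto
qed

lemma Sigma_wave: "\<alpha> \<in> {0..1} \<Longrightarrow> c \<alpha> = 1 \<Longrightarrow> \<alpha> \<in> Sigma_set lam \<kappa> wave_u0 wave_rho0"
  by (simp add: Sigma_set_def C_wave)

lemma is_N_wave: "is_N lam \<kappa> wave_u0 wave_rho0 m \<longleftrightarrow> m = 1"
proof -
  have "is_N lam \<kappa> wave_u0 wave_rho0 1"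
    unfolding is_N_def is_maximum_def wave_rho0_eq deriv_wave_u0
  proof
    have "0 \<in> Sigma_set lam \<kappa> wave_u0 wave_rho0" "wave_rho0 0 \<noteq> 0"
      using Sigma_wave[of 0] wave_rho0_eq(3)[of 0] by (simp_all add: c_def)
    then show "1 \<in> {2 / 3 * c \<alpha> + 1 / 3 |\<alpha>. \<alpha> \<in> Sigma_set lam \<kappa> wave_u0 wave_rho0 \<and> wave_rho0 \<alpha> \<noteq> 0}"
      by (intro CollectI exI[of _ 0]) (simp add: c_def)
    have "2 / 3 * c \<alpha> + 1 / 3 \<le> 1" for \<alpha> using c_bounds(2)[of \<alpha>] by simp
    then show "\<forall>s\<in>{2 / 3 * c \<alpha> + 1 / 3 |\<alpha>. \<alpha> \<in> Sigma_set lam \<kappa> wave_u0 wave_rho0 \<and> wave_rho0 \<alpha> \<noteq> 0}. s \<le> 1"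
      by blast
  qed
  then show ?thesis unfolding is_N_def is_maximum_def by (meson order_antisym)
qed

text \<open>
  Where \<open>C = 0\<close> the cosine is \<open>\<plusminus>1/2\<close>, so \<open>M\<close> cannot compete with \<open>N = 1\<close>.
\<close>

lemma is_M_wave: "is_M lam \<kappa> wave_u0 wave_rho0 m \<Longrightarrow> m \<le> 2 / 3"
proof -
  assume "is_M lam \<kappa> wave_u0 wave_rho0 m"
  then obtain \<alpha> where "m = 2 * lam * deriv wave_u0 \<alpha>" and \<alpha>: "\<alpha> \<in> Omega_set lam \<kappa> wave_u0 wave_rho0"
    unfolding is_M_def is_maximum_def by blast
  then have "m = 2 * (lam * deriv wave_u0 \<alpha>)" by simp
  then show ?thesis unfolding deriv_wave_u0 using Omega_wave[OF \<alpha>] by linarith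
qed

lemma is_larger_MN_wave: "is_larger_MN lam \<kappa> wave_u0 wave_rho0 m \<longleftrightarrow> m = 1"
proof -
  have "is_larger_MN lam \<kappa> wave_u0 wave_rho0 1"
    unfolding is_larger_MN_def is_maximum_def using is_N_wave is_M_wave by force
  then show ?thesis unfolding is_larger_MN_def is_maximum_def by (meson order_antisym)
qed

lemma alpha_bar_wave: "alpha_bar lam \<kappa> wave_u0 wave_rho0 = {0, 1}"
proof -
  have "\<alpha> \<in> alpha_bar lam \<kappa> wave_u0 wave_rho0 \<longleftrightarrow> \<alpha> \<in> {0..1} \<and> c \<alpha> = 1" for \<alpha>
  proof -
    have "\<not> is_M lam \<kappa> wave_u0 wave_rho0 1" using is_M_wave[of 1] by auto
    then have "\<alpha> \<in> alpha_bar lam \<kappa> wave_u0 wave_rho0 \<longleftrightarrow> \<alpha> \<in> Sigma_set lam \<kappa> wave_u0 wave_rho0 \<and> 2 / 3 * c \<alpha> + 1 / 3 = 1"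
      using less_imp_neq[OF wave_rho0_eq(3)[of \<alpha>]] by (simp add: alpha_bar_def is_larger_MN_wave is_N_wave wave_rho0_eq deriv_wave_u0)
    then show ?thesis using Sigma_wave by (auto simp: Sigma_set_def)
  qed
  then show ?thesis using cos_2pi_eq_1_iff by (fastforce simp: c_def)
qed

lemma alpha_bar_iff: "\<alpha> \<in> {0..1} \<Longrightarrow> \<alpha> \<in> alpha_bar lam \<kappa> wave_u0 wave_rho0 \<longleftrightarrow> c \<alpha> = 1"
  using cos_2pi_eq_1_iff[of \<alpha>] by (simp add: alpha_bar_wave c_def)

lemma Q_wave_1: "Q lam \<kappa> wave_u0 wave_rho0 \<alpha> 1 = 4 / 9 * (1 - c \<alpha>) * (2 - c \<alpha>)"
  by (simp add: Q_wave field_simps)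

lemma single_root_wave: "single_root_data lam \<kappa> wave_u0 wave_rho0 1"
  unfolding single_root_data_def
proof (intro conjI ballI)
  show Z: "{\<alpha> \<in> {0..1}. Q lam \<kappa> wave_u0 wave_rho0 \<alpha> 1 = 0} = alpha_bar lam \<kappa> wave_u0 wave_rho0"
  proof -
    have "Q lam \<kappa> wave_u0 wave_rho0 \<alpha> 1 = 0 \<longleftrightarrow> c \<alpha> = 1" for \<alpha>
      using c_bounds(2)[of \<alpha>] by (auto simp: Q_wave_1)
    then have "{\<alpha> \<in> {0..1}. Q lam \<kappa> wave_u0 wave_rho0 \<alpha> 1 = 0} = {\<alpha> \<in> {0..1}. \<alpha> \<in> alpha_bar lam \<kappa> wave_u0 wave_rho0}"
      using alpha_bar_iff by blast
    then show ?thesis using alpha_bar_wave by auto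
  qed
  show "is_eta_star lam \<kappa> wave_u0 wave_rho0 1"
    unfolding is_eta_star_def
  proof (intro conjI allI impI ballI)
    show "\<exists>\<alpha>\<in>{0..1}. Q lam \<kappa> wave_u0 wave_rho0 \<alpha> 1 = 0" using Z alpha_bar_wave by blast
    fix y \<alpha> :: real assume "0 < y \<and> y < 1"
    then show "Q lam \<kappa> wave_u0 wave_rho0 \<alpha> y \<noteq> 0" using Q_pos[of y \<alpha>] by auto
  qed simp
  show "\<exists>m. is_larger_MN lam \<kappa> wave_u0 wave_rho0 m \<and> 1 = 1 / m" by (simp add: is_larger_MN_wave)
  show "finite (alpha_bar lam \<kappa> wave_u0 wave_rho0)" by (simp add: alpha_bar_wave)
  fix \<alpha> assume "\<alpha> \<in> alpha_bar lam \<kappa> wave_u0 wave_rho0"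
  then have c: "c \<alpha> = 1" by (auto simp: alpha_bar_wave c_def)
  have "Q_poly lam \<kappa> wave_u0 wave_rho0 \<alpha> = [:1, - 4 / 3, 1 / 3:]"
    using deriv_wave_u0[of \<alpha>] by (simp add: Q_poly_def C_wave c)
  also have "\<dots> = [:- 1, 1:] * [:- 1, 1 / 3:]" by simp
  finally have e: "Q_poly lam \<kappa> wave_u0 wave_rho0 \<alpha> = [:- 1, 1:] * [:- 1, 1 / 3:]" .
  have "order 1 [:- 1, 1 / 3 :: real:] = 0" by (rule order_0I) simp
  moreover have "order 1 [:- 1, 1 :: real:] = 1" using order_power_n_n[of 1 1] by simp
  ultimately show "order 1 (Q_poly lam \<kappa> wave_u0 wave_rho0 \<alpha>) = 1"
    unfolding e by (subst order_mult) auto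
qed

section \<open>The change of time variable\<close>

lemma Q_wave_nonneg: "y \<in> {0..1} \<Longrightarrow> 0 \<le> QQ x y"
  using c_bounds(2)[of x] unfolding Q_wave by (intro mult_nonneg_nonneg add_nonneg_nonneg) auto

lemma wave_p_pos: "0 < p"
  using lam by (simp add: p_def field_simps)

lemma continuous_on_P_wave: "continuous_on {0..1} P"
proof -
  have "continuous_on ({0..1} \<times> cbox 0 1) (\<lambda>(y, x). q x y)"
    unfolding q_def case_prod_unfold
    by (intro continuous_on_powr' continuous_intros) (use Q_wave_nonneg wave_p_pos in auto)
  from integral_continuous_on_param[OF this] show ?thesis
    by (simp add: P_def[abs_def] F_def prim_1)
qed

lemma P_wave_pos: assumes y: "y \<in> {0..1}" shows "0 < P y"
proof -
  have cont: "continuous_on {0..1} (\<lambda>x. q x y)"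
    unfolding q_def
    by (intro continuous_on_powr' continuous_intros) (use Q_wave_nonneg[OF y] wave_p_pos in auto)
  have "0 < QQ (1 / 2) y" unfolding Q_wave c_def using y by (intro mult_pos_pos) auto
  then have "q (1 / 2) y \<noteq> 0" by (simp add: q_def)
  then have "P y \<noteq> 0"
    unfolding P_def F_def prim_1 using integral_eq_0_iff[OF cont] by (force simp: q_def)
  moreover have "0 \<le> P y"
    unfolding P_def F_def prim_1
    by (intro integral_nonneg integrable_continuous_real cont) (simp add: q_def)
  ultimately show ?thesis by simp
qed

text \<open>
  The rate \<open>dt/d\<eta>\<close>.  Clamping to the unit interval extends it to a positive continuous function on the line, so
  that its primitive has an inverse that is differentiable everywhere, the initial and the final time included.
\<close>

definition "clock_rate y = P (max 0 (min 1 y)) powr (2 * lam)"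

lemma clock_rate_pos: "0 < clock_rate y" and continuous_on_clock_rate: "continuous_on UNIV clock_rate"
proof -
  have in01: "max 0 (min 1 y) \<in> {0..1::real}" for y by auto
  show "0 < clock_rate y" using P_wave_pos[OF in01, of y] by (simp add: clock_rate_def)
  have "continuous_on UNIV (\<lambda>y. P (max 0 (min 1 y)))"
    by (rule continuous_on_compose2[OF continuous_on_P_wave]) (auto intro!: continuous_intros)
  then show "continuous_on UNIV clock_rate"
    unfolding clock_rate_def[abs_def]
    by (rule continuous_on_powr[OF _ continuous_on_const]) (use P_wave_pos[OF in01] in \<open>force simp: less_imp_neq[symmetric]\<close>)
qed

lemma clock_rate_eq: "y \<in> {0..1} \<Longrightarrow> clock_rate y = P y powr (2 * lam)"
  by (cases "y = 1") (simp_all add: clock_rate_def min_def max_def)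

text \<open>
  Time as a function of \<open>\<eta>\<close>.
\<close>

definition "clock = prim clock_rate"

lemma DERIV_clock: "(clock has_real_derivative clock_rate y) (at y)"
  unfolding clock_def by (rule DERIV_prim[OF continuous_on_clock_rate])

lemma clock_0: "clock 0 = 0" by (simp add: clock_def)

lemma strict_mono_clock: "strict_mono clock"
  by (rule strict_mono_DERIV_pos[OF DERIV_clock clock_rate_pos])

lemma surj_clock: "surj clock"
proof (rule surj_of_unbounded)
  show "continuous_on UNIV clock"
    by (rule DERIV_continuous_on) (rule has_field_derivative_at_within[OF DERIV_clock])
  obtain m where m: "0 < m" "\<And>y. m \<le> clock_rate y"
  proof -
    have "continuous_on {0..1} clock_rate" by (rule continuous_on_subset[OF continuous_on_clock_rate]) simp
    then obtain z where z: "\<forall>y\<in>{0..1}. clock_rate z \<le> clock_rate y"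
      using continuous_attains_inf[of "{0..1::real}" clock_rate] by auto
    have "clock_rate z \<le> clock_rate y" for y
    proof -
      have "clock_rate y = clock_rate (max 0 (min 1 y))" by (simp add: clock_rate_def)
      then show ?thesis using z by simp
    qed
    then show ?thesis using that clock_rate_pos by blast
  qed
  have inc: "m * (b - a) \<le> clock b - clock a" if ab: "a < b" for a b
  proof -
    obtain z where "clock b - clock a = (b - a) * clock_rate z" using MVT2[OF ab, of clock clock_rate] DERIV_clock by blast
    then show ?thesis using mult_right_mono[OF m(2)[of z], of "b - a"] ab by (simp add: mult.commute)
  qed
  fix y :: real
  define b where "b = (\<bar>y\<bar> + 1) / m"
  have b: "0 < b" "m * b = \<bar>y\<bar> + 1" using m(1) by (simp_all add: b_def)
  have "y \<le> clock b" using inc[of 0 b] b clock_0 by simp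
  then show "\<exists>b. y \<le> clock b" ..
  have "clock (- b) \<le> y" using inc[of "- b" 0] b clock_0 by simp
  then show "\<exists>a. clock a \<le> y" ..
qed

definition "\<eta> = inv clock"
definition "ts = clock 1"

lemma clock_eta: "clock (\<eta> t) = t" and eta_clock: "\<eta> (clock y) = y"
  unfolding \<eta>_def using surj_f_inv_f[OF surj_clock] inv_f_f[OF strict_mono_imp_inj_on[OF strict_mono_clock]]
  by auto

lemma eta_less_iff: "\<eta> s < \<eta> t \<longleftrightarrow> s < t"
  using strict_mono_less[OF strict_mono_clock, of "\<eta> s" "\<eta> t"] by (simp add: clock_eta)

lemma eta_0: "\<eta> 0 = 0" and eta_ts: "\<eta> ts = 1"
  using eta_clock[of 0] eta_clock[of 1] by (simp_all add: clock_0 ts_def)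

lemma ts_pos: "0 < ts"
  using strict_monoD[OF strict_mono_clock, of 0 1] by (simp add: clock_0 ts_def)

lemma eta_range: "t \<in> {0..<ts} \<Longrightarrow> \<eta> t \<in> {0..<1}"
  using eta_less_iff[of t 0] eta_less_iff[of t ts] by (auto simp: eta_0 eta_ts not_less[symmetric])

lemma DERIV_eta_wave: "(\<eta> has_real_derivative 1 / clock_rate (\<eta> t)) (at t)"
  unfolding \<eta>_def by (rule DERIV_inv[OF DERIV_clock clock_rate_pos surj_clock])

lemma is_eta_wave: "is_eta lam \<kappa> wave_u0 wave_rho0 ts \<eta>"
  unfolding is_eta_def
proof (intro conjI ballI)
  show "strict_mono_on {0..<ts} \<eta>" by (auto intro!: strict_mono_onI simp: eta_less_iff)
  fix t assume t: "t \<in> {0..<ts}"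
  then have "clock_rate (\<eta> t) = P (\<eta> t) powr (2 * lam)" using eta_range[OF t] by (intro clock_rate_eq) auto
  then have "1 / clock_rate (\<eta> t) = P0_bar lam \<kappa> wave_u0 wave_rho0 (\<eta> t) powr (- 2 * lam)"
    using powr_minus_divide[of "P (\<eta> t)" "2 * lam"] by (simp add: P0_bar_eq)
  then show "(\<eta> has_real_derivative P0_bar lam \<kappa> wave_u0 wave_rho0 (\<eta> t) powr (- 2 * lam)) (at t within {0..<ts})"
    using has_field_derivative_at_within[OF DERIV_eta_wave[of t]] by simp
qed (rule eta_0)

lemma filterlim_eta: "filterlim \<eta> (at_left 1) (at_left ts)"
  unfolding filterlim_at
proof
  have "isCont \<eta> ts" by (rule DERIV_isCont[OF DERIV_eta_wave])
  then show "(\<eta> \<longlongrightarrow> 1) (at_left ts)"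
    by (simp add: isCont_def eta_ts filterlim_at_split)
  show "\<forall>\<^sub>F t in at_left ts. \<eta> t \<in> {..<1} \<and> \<eta> t \<noteq> 1"
    unfolding eventually_at_left[OF ts_pos]
  proof (intro exI[of _ 0] conjI allI impI ts_pos)
    fix t assume "t < ts"
    then have "\<eta> t < 1" using eta_less_iff[of t ts] by (simp only: eta_ts)
    then show "\<eta> t \<in> {..<1}" "\<eta> t \<noteq> 1" by auto
  qed
qed

lemma is_t_star_wave: "is_t_star lam \<kappa> wave_u0 wave_rho0 1 ts"
  unfolding is_t_star_def
proof -
  let ?I = "\<lambda>\<sigma>. (integral {0..1} (\<lambda>\<alpha>. 1 / (C \<alpha> * \<sigma>\<^sup>2 - 2 * lam * deriv wave_u0 \<alpha> * \<sigma> + 1) powr (1 / (2 * lam)))) powr (2 * lam)"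
  have I: "?I \<sigma> = clock_rate \<sigma>" if "\<sigma> \<in> {0..1}" for \<sigma>
  proof -
    have "1 / (C \<alpha> * \<sigma>\<^sup>2 - 2 * lam * deriv wave_u0 \<alpha> * \<sigma> + 1) powr (1 / (2 * lam)) = q \<alpha> \<sigma>" for \<alpha>
      unfolding Q_def[symmetric] q_def p_def by (simp add: powr_minus_divide)
    then show ?thesis using that by (simp add: clock_rate_eq P_def F_def prim_1)
  qed
  have eq: "integral {0..y} ?I = clock y" if y: "y \<in> {0<..<1}" for y
  proof -
    have "(clock_rate has_integral (clock y - clock 0)) {0..y}"
      using y by (intro fundamental_theorem_of_calculus)
        (auto simp: has_real_derivative_iff_has_vector_derivative[symmetric]
          intro: has_field_derivative_at_within[OF DERIV_clock])
    then have "(?I has_integral (clock y - clock 0)) {0..y}"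
      by (rule has_integral_eq[rotated]) (use y I in auto)
    then show ?thesis by (simp add: integral_unique clock_0)
  qed
  have "isCont clock 1" by (rule DERIV_isCont[OF DERIV_clock])
  then have "(clock \<longlongrightarrow> ts) (at_left 1)" by (simp add: isCont_def ts_def filterlim_at_split)
  moreover have "\<forall>\<^sub>F y in at_left 1. clock y = integral {0..y} ?I"
    unfolding eventually_at_left[OF zero_less_one] using eq by (intro exI[of _ 0]) simp
  ultimately show "((\<lambda>y. integral {0..y} ?I) \<longlongrightarrow> ts) (at_left 1)"
    by (rule Lim_transform_eventually)
qed

section \<open>The nonlocal term\<close>

text \<open>
  \<open>num\<close> is \<open>- Q\<^sub>\<eta> / 2\<close>, hence positive at the points where \<open>Q\<close> first vanishes (\<open>num_ge\<close>).
\<close>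

definition "r = 1 + 1 / (2 * lam)"
definition "num x y = 2 / 3 * c x - y * C x"
definition "nonlocal y = integral {0..1} (\<lambda>x. num x y / QQ x y powr r)"

lemma ux_formula_wave:
  "ux_formula lam \<kappa> wave_u0 wave_rho0 x y = E y / lam * (num x y / QQ x y - nonlocal y / P y)"
  unfolding ux_formula_def P0_bar_eq nonlocal_def num_def r_def deriv_wave_u0 by (simp add: E_def)

lemma r_less_1: "r < 1"
  using lam by (simp add: r_def)

lemma num_eq: "num x y = 2 / 3 * c x - y * ((4 * (c x)\<^sup>2 - 1) / 9)"
  by (simp add: num_def C_wave)

lemma abs_num_le: assumes "y \<in> {0..1}" shows "\<bar>num x y\<bar> \<le> 1"
proof -
  have "0 \<le> (c x)\<^sup>2" "(c x)\<^sup>2 \<le> 1" using c_bounds[of x] by (simp_all add: abs_square_le_1 abs_le_iff)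
  moreover have "\<bar>(4 * s - 1) / 9\<bar> \<le> 1 / 3" if "0 \<le> s" "s \<le> 1" for s :: real
    using that by (simp add: abs_if)
  ultimately have "\<bar>(4 * (c x)\<^sup>2 - 1) / 9\<bar> \<le> 1 / 3" by blast
  then have "\<bar>y * ((4 * (c x)\<^sup>2 - 1) / 9)\<bar> \<le> 1 * (1 / 3)"
    unfolding abs_mult using assms by (intro mult_mono) auto
  then show ?thesis unfolding num_eq using c_bounds[of x] by (auto simp: abs_le_iff)
qed

text \<open>
  For \<open>cos \<ge> 1/2\<close> the expression decreases in \<open>y\<close>, and at \<open>y = 1\<close> it is \<open>1/3 + (2/9) (2 cos - 1) (1 - cos)\<close>.
\<close>

lemma num_ge: assumes "y \<in> {0..1}" "1 / 2 \<le> c x" shows "1 / 3 \<le> num x y"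
proof -
  have "0 \<le> (2 * c x - 1) * (1 - c x)" using assms(2) c_bounds(2)[of x] by simp
  moreover have "0 \<le> (2 * c x - 1) * (2 * c x + 1)" using assms(2) by (intro mult_nonneg_nonneg) auto
  then have "0 \<le> (4 * (c x)\<^sup>2 - 1) / 9" by (simp add: power2_eq_square algebra_simps)
  then have "y * ((4 * (c x)\<^sup>2 - 1) / 9) \<le> 1 * ((4 * (c x)\<^sup>2 - 1) / 9)"
    using assms by (intro mult_right_mono) auto
  ultimately show ?thesis unfolding num_eq by (simp add: power2_eq_square field_simps)
qed

lemma Q_bounds:
  assumes y: "y \<in> {0..<1}"
  shows "QQ x y \<le> 4" "2 / 3 * (1 - y) \<le> QQ x y"
    "QQ x y \<le> 2 * ((1 - y) + 2 / 3 * (1 - c x))"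
    "1 / 2 \<le> y \<Longrightarrow> 2 / 9 * (1 - c x) \<le> QQ x y"
proof -
  define d where "d = 1 - c x"
  have d: "0 \<le> d" "d \<le> 2" using c_bounds[of x] by (auto simp: d_def)
  define e where "e = y * d"
  define A B where "A = (1 - y) + 2 / 3 * e" and "B = (1 - y / 3) + 2 / 3 * e"
  have Q: "QQ x y = A * B" by (simp add: Q_wave A_def B_def d_def e_def mult.assoc)
  have e0: "0 \<le> e" unfolding e_def using y d by (intro mult_nonneg_nonneg) auto
  have ed: "e \<le> d" unfolding e_def using y d mult_right_mono[of y 1 d] by simp
  have ey: "e \<le> 2 * y" unfolding e_def using y d mult_left_mono[of d 2 y] by simp
  have A: "1 - y \<le> A" "A \<le> (1 - y) + 2 / 3 * d" "A \<le> 2" using e0 ed ey y by (auto simp: A_def)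
  have B: "2 / 3 \<le> B" "B \<le> 2" using e0 ey y by (auto simp: B_def)
  have "A * B \<le> 2 * 2" using A B y by (intro mult_mono) auto
  then show "QQ x y \<le> 4" by (simp add: Q)
  have "(1 - y) * (2 / 3) \<le> A * B" using A B y by (intro mult_mono) auto
  then show "2 / 3 * (1 - y) \<le> QQ x y" by (simp add: Q)
  have "A * B \<le> ((1 - y) + 2 / 3 * d) * 2" using A B y d by (intro mult_mono) auto
  then show "QQ x y \<le> 2 * ((1 - y) + 2 / 3 * (1 - c x))" by (simp only: Q d_def mult.commute)
  assume "1 / 2 \<le> y"
  then have "1 / 2 * d \<le> e" unfolding e_def using d by (intro mult_right_mono) auto
  then have "1 / 3 * d \<le> A" using y by (simp add: A_def)
  then have "1 / 3 * d * (2 / 3) \<le> A * B" using A B y d by (intro mult_mono) auto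
  then show "2 / 9 * (1 - c x) \<le> QQ x y" by (simp add: Q d_def)
qed

lemma Q_powr_bound:
  assumes y: "y \<in> {0..<1}" and l: "0 < l" "l \<le> QQ x y"
  shows "\<bar>num x y / QQ x y powr r\<bar> \<le> l powr (- r) + 4 powr (- r)"
proof -
  have "QQ x y powr (- r) \<le> l powr (- r) + 4 powr (- r)"
    using Q_bounds(1)[OF y, of x] l by (intro powr_le_add)
  moreover have "\<bar>num x y\<bar> * QQ x y powr (- r) \<le> 1 * QQ x y powr (- r)"
    using abs_num_le[of y x] y by (intro mult_right_mono) auto
  ultimately show ?thesis by (simp add: abs_mult powr_minus_divide)
qed

lemma continuous_integrand:
  assumes y: "y \<in> {0..<1}" shows "continuous_on S (\<lambda>x. num x y / QQ x y powr r)"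
proof -
  have D: "y \<in> D" using y by auto
  then show ?thesis unfolding num_def c_def
    using Q_pos[OF D] by (intro continuous_intros ballI) (auto simp: less_imp_neq[symmetric])
qed

text \<open>
  The integrand is at most a constant times \<open>(1 - y)\<^bsup>-r\<^esup>\<close> (up to a bounded term), and \<open>r < 1\<close>.
\<close>

lemma nonlocal_negligible: "((\<lambda>y. (1 - y) * nonlocal y) \<longlongrightarrow> 0) (at_left 1)"
proof -
  define b where "b = (\<lambda>y::real. (1 - y) * ((2 / 3 * (1 - y)) powr (- r) + 4 powr (- r)))"
  have "((\<lambda>y. (2 / 3) powr (- r) * (1 - y) powr (1 - r) + (1 - y) * 4 powr (- r)) \<longlongrightarrow>
      (2 / 3) powr (- r) * 0 + 0 * 4 powr (- r)) (at_left 1)"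
  proof (intro tendsto_intros)
    have l: "((\<lambda>y::real. 1 - y) \<longlongrightarrow> 0) (at_left 1)" by real_asymp
    then show "((\<lambda>y::real. 1 - y) \<longlongrightarrow> 0) (at_left 1)" .
    show "((\<lambda>y::real. (1 - y) powr (1 - r)) \<longlongrightarrow> 0) (at_left 1)"
      using r_less_1 tendsto_powr'[OF l tendsto_const, of "1 - r"]
      by (auto simp: eventually_at_filter)
  qed
  moreover have "\<forall>\<^sub>F y in at_left (1::real). (2 / 3) powr (- r) * (1 - y) powr (1 - r) + (1 - y) * 4 powr (- r) = b y"
    unfolding eventually_at_left[OF zero_less_one]
  proof (intro exI[of _ 0] conjI allI impI zero_less_one)
    fix y :: real assume y: "0 < y" "y < 1"
    have 1: "(2 / 3 * (1 - y)) powr (- r) = (2 / 3) powr (- r) * (1 - y) powr (- r)"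
      by (rule powr_mult)
    have 2: "(1 - y) powr (1 - r) = (1 - y) * (1 - y) powr (- r)"
      using powr_add[of "1 - y" 1 "- r"] y by simp
    show "(2 / 3) powr (- r) * (1 - y) powr (1 - r) + (1 - y) * 4 powr (- r) = b y"
      unfolding b_def 1 2 by (simp only: distrib_left mult_ac)
  qed
  ultimately have b: "(b \<longlongrightarrow> 0) (at_left 1)" by (auto intro: Lim_transform_eventually)
  have "norm ((1 - y) * nonlocal y) \<le> b y" if y: "0 < y" "y < 1" for y
  proof -
    have "norm (nonlocal y) \<le> integral {0..1} (\<lambda>x::real. (2 / 3 * (1 - y)) powr (- r) + 4 powr (- r))"
      unfolding nonlocal_def
    proof (rule integral_norm_bound_integral)
      show "(\<lambda>x. num x y / QQ x y powr r) integrable_on {0..1}"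
        using y by (intro integrable_continuous_real continuous_integrand) auto
      fix x
      show "norm (num x y / QQ x y powr r) \<le> (2 / 3 * (1 - y)) powr (- r) + 4 powr (- r)"
        unfolding real_norm_def by (rule Q_powr_bound) (use y Q_bounds(2)[of y x] in auto)
    qed (rule integrable_const_ivl)
    then have "(1 - y) * norm (nonlocal y) \<le> b y" unfolding b_def using y by (intro mult_left_mono) auto
    then show ?thesis using y by (simp add: abs_mult)
  qed
  then have "\<forall>\<^sub>F y in at_left 1. norm ((1 - y) * nonlocal y) \<le> b y"
    unfolding eventually_at_left[OF zero_less_one] by (intro exI[of _ 0]) auto
  then show ?thesis by (rule Lim_null_comparison[OF _ b])
qed

text \<open>
  By \<open>Q \<ge> (2/9) (1 - cos) \<ge> (4/9) m\<^sup>2\<close>, where \<open>m\<close> is the distance to the nearest endpoint, the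
  integrand is dominated by \<open>m\<^bsup>-2r\<^esup>\<close> up to constants.  This is integrable since \<open>\<lambda> > -1\<close> means \<open>2 r < 1\<close>.
\<close>

lemma nonlocal_converges:
  assumes "-1 < lam" shows "\<exists>L. (nonlocal \<longlongrightarrow> L) (at_left 1)"
proof -
  have r: "- 1 < 2 * - r" using assms lam by (simp add: r_def field_simps)
  define h where "h = (\<lambda>x::real. (4 / 9) powr (- r) * (x powr (2 * - r) + (1 - x) powr (2 * - r)) + 4 powr (- r))"
  have "(\<lambda>x::real. x powr (2 * - r)) integrable_on {0..1}"
    using has_integral_powr_from_0[OF r, of 1] by (simp add: has_integral_iff)
  moreover have "(\<lambda>x::real. (1 - x) powr (2 * - r)) integrable_on {0..1}"
    using integrable_affinity[of "\<lambda>x. x powr (2 * - r)" 0 1 "-1" 1] calculation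
    by (simp add: image_affinity_atLeastAtMost_diff)
  ultimately have "h integrable_on {0..1}"
    unfolding h_def by (intro integrable_add integrable_on_mult_right integrable_const_ivl)
  then have h: "h integrable_on {0<..<1}" by (simp add: integrable_on_Icc_iff_Ioo)
  have le: "norm (num x y / QQ x y powr r) \<le> h x" if x: "x \<in> {0<..<1}" and y: "y \<in> {1/2..<1}" for x y
  proof -
    define m where "m = min x (1 - x)"
    have m: "0 < m" using x by (simp add: m_def)
    have "4 / 9 * m\<^sup>2 \<le> QQ x y"
      using Q_bounds(4)[of y x] one_minus_cos_ge[of x] x y by (simp add: m_def c_def)
    then have "\<bar>num x y / QQ x y powr r\<bar> \<le> (4 / 9 * m\<^sup>2) powr (- r) + 4 powr (- r)"
      using m y by (intro Q_powr_bound) auto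
    also have "(4 / 9 * m\<^sup>2) powr (- r) = (4 / 9) powr (- r) * m powr (2 * - r)"
    proof -
      have "m\<^sup>2 = m powr 2" using m by simp
      then have "(m\<^sup>2) powr (- r) = m powr (2 * - r)" by (simp only: powr_powr)
      then show ?thesis by (simp only: powr_mult)
    qed
    also have "\<dots> \<le> (4 / 9) powr (- r) * (x powr (2 * - r) + (1 - x) powr (2 * - r))"
    proof (intro mult_left_mono powr_ge_zero)
      have "m = x \<or> m = 1 - x" by (auto simp: m_def min_def)
      then show "m powr (2 * - r) \<le> x powr (2 * - r) + (1 - x) powr (2 * - r)"
        by (elim disjE) simp_all
    qed
    finally show ?thesis by (simp add: h_def)
  qed
  define L where "L = integral {0<..<1} (\<lambda>x. num x 1 / QQ x 1 powr r)"
  have "(nonlocal \<longlongrightarrow> L) (at_left 1)"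
  proof (rule tendsto_at_left_sequentially[where b="1/2"])
    fix S :: "nat \<Rightarrow> real"
    assume S: "\<And>n. S n < 1" "\<And>n. 1 / 2 < S n" "S \<longlonglongrightarrow> 1"
    have S': "S n \<in> {1/2..<1}" "S n \<in> {0..<1}" for n using S(1,2)[of n] by auto
    have "(\<lambda>n. integral {0<..<1} (\<lambda>x. num x (S n) / QQ x (S n) powr r)) \<longlonglongrightarrow> L"
      unfolding L_def
    proof (rule dominated_convergence(2)[OF _ h])
      show "(\<lambda>x. num x (S n) / QQ x (S n) powr r) integrable_on {0<..<1}" for n
        using integrable_continuous_real[OF continuous_integrand[OF S'(2)[of n]], of 0 1]
        by (simp add: integrable_on_Icc_iff_Ioo)
      show "norm (num x (S n) / QQ x (S n) powr r) \<le> h x" if "x \<in> {0<..<1}" for n x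
        by (rule le[OF that S'(1)])
      show "(\<lambda>n. num x (S n) / QQ x (S n) powr r) \<longlonglongrightarrow> num x 1 / QQ x 1 powr r"
        if x: "x \<in> {0<..<1}" for x
      proof -
        have "c x \<noteq> 1" using cos_2pi_eq_1_iff[of x] x by (simp add: c_def)
        then have nz: "QQ x 1 \<noteq> 0" using c_bounds(2)[of x] by (auto simp: Q_wave_1)
        then show "(\<lambda>n. num x (S n) / QQ x (S n) powr r) \<longlonglongrightarrow> num x 1 / QQ x 1 powr r"
          unfolding num_def Q_eq by (intro tendsto_intros S(3)) (use nz in \<open>simp_all add: Q_eq\<close>)
      qed
    qed
    then show "(\<lambda>n. nonlocal (S n)) \<longlonglongrightarrow> L" unfolding nonlocal_def integral_open_interval_real .
  qed simp
  then show ?thesis ..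
qed

text \<open>
  For \<open>\<lambda> \<le> -1\<close> we have \<open>r \<ge> 1/2\<close>.  On \<open>[0, 1/6]\<close>, where the numerator is at least \<open>1/3\<close>, the bound
  \<open>Q \<le> 49 (s + x)\<^sup>2\<close> with \<open>s = \<surd>(1 - y)\<close> makes the integrand at least a multiple of \<open>1/(s + x)\<close>, whose integral
  grows like \<open>- ln s\<close>.  On the rest of the period the integrand is bounded below.
\<close>

lemma nonlocal_diverges:
  assumes "lam \<le> -1" shows "filterlim nonlocal at_top (at_left 1)"
proof -
  have r: "1 / 2 \<le> r" "0 \<le> r" using assms by (simp_all add: r_def field_simps)
  have lower: "- 9 + (ln (1 / 6) - ln (sqrt (1 - y))) / 42 \<le> nonlocal y" if y: "1 / 2 < y" "y < 1" for y
  proof -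
    define s where "s = sqrt (1 - y)"
    have s: "0 < s" "s\<^sup>2 = 1 - y" using y by (auto simp: s_def)
    have y': "y \<in> {0..<1}" "y \<in> {0..1}" "y \<in> D" using y by auto
    define f where "f = (\<lambda>x. num x y / QQ x y powr r)"
    have f: "f integrable_on {a..b}" for a b
      unfolding f_def by (intro integrable_continuous_real continuous_integrand y')
    have f1: "- 9 \<le> f x" for x
    proof (cases "1 / 2 \<le> c x")
      case True
      then have "0 \<le> f x" using num_ge[OF y'(2) True] by (simp add: f_def)
      then show ?thesis by simp
    next
      case False
      then have "1 / 9 \<le> QQ x y" using Q_bounds(4)[OF y'(1), of x] y by simp
      then have "QQ x y powr (- r) \<le> (1 / 9) powr (- r)" using r by (intro powr_mono2') auto
      also have "(1 / 9) powr (- r) = 9 powr r" by (simp add: powr_minus_divide powr_divide)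
      also have "\<dots> \<le> 9 powr 1" using r_less_1 by (intro powr_mono) auto
      finally have "QQ x y powr (- r) \<le> 9" by simp
      moreover have "\<bar>num x y\<bar> * QQ x y powr (- r) \<le> 1 * QQ x y powr (- r)"
        using abs_num_le[OF y'(2), of x] by (intro mult_right_mono) auto
      ultimately have "\<bar>f x\<bar> \<le> 9" by (simp add: f_def abs_mult powr_minus_divide)
      then show ?thesis by simp
    qed
    have f2: "1 / 42 * (1 / (s + x)) \<le> f x" if x: "x \<in> {0..1/6}" for x
    proof -
      have "pi * (2 * x) \<le> pi * (1 / 3)" using x by (intro mult_left_mono) auto
      then have "cos (pi / 3) \<le> c x"
        unfolding c_def using x by (intro cos_monotone_0_pi_le) (auto simp: mult_ac)
      then have num: "1 / 3 \<le> num x y" using num_ge[OF y'(2)] by (simp add: cos_60)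
      have Qp: "0 < QQ x y" by (rule Q_pos[OF y'(3)])
      have "QQ x y \<le> 2 * (s\<^sup>2 + 2 / 3 * (1 - c x))"
        using Q_bounds(3)[OF y'(1), of x] by (simp only: s)
      also have "\<dots> \<le> 2 * (s\<^sup>2 + 2 / 3 * (32 * x\<^sup>2))"
        using one_minus_cos_le[of x] unfolding c_def by (intro mult_left_mono add_left_mono) auto
      also have "\<dots> \<le> 2 * (s\<^sup>2 + 2 / 3 * (32 * x\<^sup>2)) + (47 * s\<^sup>2 + 19 / 3 * x\<^sup>2 + 98 * (s * x))"
        using s(1) x by simp
      also have "\<dots> = 49 * (s + x)\<^sup>2" by (simp add: power2_sum field_simps)
      finally have sq: "QQ x y \<le> (7 * (s + x))\<^sup>2" unfolding power_mult_distrib by simp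
      \<comment> \<open>Dividing by the upper bound 4 brings \<open>Q\<close> into the unit interval, where powers decrease in the exponent.\<close>
      have "(QQ x y / 4) powr r \<le> (QQ x y / 4) powr (1 / 2)"
        using Q_bounds(1)[OF y'(1), of x] Qp r by (intro powr_mono') auto
      also have "\<dots> = sqrt (QQ x y) / 2" using Qp by (simp add: powr_half_sqrt real_sqrt_divide)
      also have "sqrt (QQ x y) \<le> 7 * (s + x)" using sq s x by (intro real_le_lsqrt) auto
      finally have "(QQ x y / 4) powr r \<le> 7 * (s + x) / 2" by simp
      moreover have "4 powr r \<le> (4::real) powr 1" using r_less_1 by (intro powr_mono) auto
      ultimately have "4 powr r * (QQ x y / 4) powr r \<le> 4 * (7 * (s + x) / 2)"
        by (intro mult_mono) auto
      also have "4 powr r * (QQ x y / 4) powr r = QQ x y powr r"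
        using Qp by (simp add: powr_divide)
      finally have "QQ x y powr r \<le> 14 * (s + x)" by simp
      then have "1 / 3 / (14 * (s + x)) \<le> num x y / QQ x y powr r"
        using num Qp by (intro frac_le) auto
      then show ?thesis by (simp add: f_def)
    qed
    have "((\<lambda>x. 1 / 42 * (1 / (s + x))) has_integral (1 / 42 * (ln (s + 1 / 6) - ln (s + 0)))) {0..1/6}"
      by (intro has_integral_mult_right fundamental_theorem_of_calculus)
         (use s in \<open>auto intro!: derivative_eq_intros
            simp: has_real_derivative_iff_has_vector_derivative[symmetric]\<close>)
    then have "1 / 42 * (ln (s + 1 / 6) - ln (s + 0)) \<le> integral {0..1/6} f"
      by (rule has_integral_le[OF _ integrable_integral[OF f] f2])
    moreover have "integral {1/6..1} (\<lambda>x::real. - 9) \<le> integral {1/6..1} f"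
      by (intro integral_le f f1) auto
    moreover have "integral {0..1/6} f + integral {1/6..1} f = nonlocal y"
      unfolding nonlocal_def f_def[symmetric] by (rule Henstock_Kurzweil_Integration.integral_combine) (auto intro: f)
    moreover have "ln (1 / 6) \<le> ln (s + 1 / 6)" using s by (intro ln_mono) auto
    ultimately show ?thesis unfolding s_def[symmetric] by (simp add: field_simps)
  qed
  have "filterlim (\<lambda>y::real. - 9 + (ln (1 / 6) - ln (sqrt (1 - y))) / 42) at_top (at_left 1)"
    by real_asymp
  then show ?thesis
  proof (rule filterlim_at_top_mono)
    show "\<forall>\<^sub>F y in at_left 1. - 9 + (ln (1 / 6) - ln (sqrt (1 - y))) / 42 \<le> nonlocal y"
      unfolding eventually_at_left[of "1/2::real" 1, simplified] using lower
      by (intro exI[of _ "1/2"]) auto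
  qed
qed

section \<open>Limits along the characteristics\<close>

lemma limits_at_1:
  "(P \<longlongrightarrow> P 1) (at_left 1)" "0 < P 1" "(E \<longlongrightarrow> E 1) (at_left 1)" "0 < E 1"
  "(QQ x \<longlongrightarrow> QQ x 1) (at_left 1)" "(num x \<longlongrightarrow> num x 1) (at_left 1)"
proof -
  show P: "(P \<longlongrightarrow> P 1) (at_left 1)"
    using continuous_on_Icc_at_leftD[OF continuous_on_P_wave] by simp
  show Pp: "0 < P 1" by (rule P_wave_pos) simp
  then show "0 < E 1" by (simp add: E_def)
  show "(E \<longlongrightarrow> E 1) (at_left 1)" unfolding E_def[abs_def] using Pp by (intro tendsto_intros P) auto
  show "(QQ x \<longlongrightarrow> QQ x 1) (at_left 1)" "(num x \<longlongrightarrow> num x 1) (at_left 1)"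
    unfolding Q_eq[abs_def] num_def[abs_def] by (intro tendsto_intros)+
qed

lemma inverse_gap_at_top: "filterlim (\<lambda>y::real. 1 / (1 - y)) at_top (at_left 1)"
  by real_asymp

text \<open>
  Factoring out \<open>1/(1 - y)\<close> leaves a factor that tends to \<open>E 1 / \<lambda>\<close> times \<open>1/2\<close>, which is negative.
\<close>

lemma ux_formula_at_bot:
  assumes x: "c x = 1"
  shows "filterlim (ux_formula lam \<kappa> wave_u0 wave_rho0 x) at_bot (at_left 1)"
proof -
  define k where "k = (\<lambda>y. E y / lam * ((2 / 3 - y / 3) / (1 - y / 3) - ((1 - y) * nonlocal y) / P y))"
  have "(k \<longlongrightarrow> E 1 / lam * ((2 / 3 - 1 / 3) / (1 - 1 / 3) - 0 / P 1)) (at_left 1)"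
    unfolding k_def using limits_at_1(2) lam
    by (intro tendsto_intros limits_at_1 nonlocal_negligible) auto
  moreover have "E 1 / lam * ((2 / 3 - 1 / 3) / (1 - 1 / 3) - 0 / P 1) < 0"
    using limits_at_1(4) lam by (simp add: divide_pos_neg)
  ultimately have lim: "filterlim (\<lambda>y. k y * (1 / (1 - y))) at_bot (at_left 1)"
    using filterlim_tendsto_neg_mult_at_bot[OF _ _ inverse_gap_at_top] by blast
  have "k y * (1 / (1 - y)) = ux_formula lam \<kappa> wave_u0 wave_rho0 x y" if "y < 1" for y
  proof -
    have "num x y / QQ x y = (2 / 3 - y / 3) / (1 - y / 3) * (1 / (1 - y))"
      by (simp add: num_eq Q_wave x)
    moreover have "nonlocal y / P y = ((1 - y) * nonlocal y) / P y * (1 / (1 - y))" using that by simp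
    ultimately show ?thesis unfolding ux_formula_wave k_def by (simp only: left_diff_distrib mult.assoc)
  qed
  then have ev: "\<forall>\<^sub>F y in at_left 1. k y * (1 / (1 - y)) = ux_formula lam \<kappa> wave_u0 wave_rho0 x y"
    unfolding eventually_at_left[OF zero_less_one] by (intro exI[of _ 0]) simp
  show ?thesis by (rule filterlim_cong[OF refl refl ev, THEN iffD1, OF lim])
qed

lemma rho_formula_at_top:
  assumes x: "c x = 1"
  shows "filterlim (rho_formula lam \<kappa> wave_u0 wave_rho0 x) at_top (at_left 1)"
proof -
  define k where "k = (\<lambda>y. E y * (wave_rho0 x / (1 - y / 3)))"
  have "(k \<longlongrightarrow> E 1 * (wave_rho0 x / (1 - 1 / 3))) (at_left 1)"
    unfolding k_def by (intro tendsto_intros limits_at_1) auto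
  moreover have "0 < E 1 * (wave_rho0 x / (1 - 1 / 3))"
    using limits_at_1(4) wave_rho0_eq(3) by (intro mult_pos_pos divide_pos_pos) auto
  ultimately have "filterlim (\<lambda>y. k y * (1 / (1 - y))) at_top (at_left 1)"
    using filterlim_tendsto_pos_mult_at_top[OF _ _ inverse_gap_at_top] by blast
  moreover have "k y * (1 / (1 - y)) = rho_formula lam \<kappa> wave_u0 wave_rho0 x y" for y
    by (simp add: k_def rho_formula_eq R_def Q_wave x mult.commute)
  ultimately show ?thesis by simp
qed

lemma Q_wave_1_nz: "c x \<noteq> 1 \<Longrightarrow> QQ x 1 \<noteq> 0"
  using c_bounds(2)[of x] by (auto simp: Q_wave_1)

lemma ux_formula_converges:
  assumes "- 1 < lam" "c x \<noteq> 1"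
  shows "\<exists>L. (ux_formula lam \<kappa> wave_u0 wave_rho0 x \<longlongrightarrow> L) (at_left 1)"
proof -
  obtain L where L: "(nonlocal \<longlongrightarrow> L) (at_left 1)" using nonlocal_converges[OF assms(1)] ..
  have "((\<lambda>y. E y / lam * (num x y / QQ x y - nonlocal y / P y)) \<longlongrightarrow>
      E 1 / lam * (num x 1 / QQ x 1 - L / P 1)) (at_left 1)"
    using limits_at_1(2) lam Q_wave_1_nz[OF assms(2)] by (intro tendsto_intros limits_at_1 L) auto
  then show ?thesis unfolding ux_formula_wave[abs_def] by blast
qed

lemma rho_formula_converges:
  assumes "c x \<noteq> 1"
  shows "\<exists>L. (rho_formula lam \<kappa> wave_u0 wave_rho0 x \<longlongrightarrow> L) (at_left 1)"
proof -
  have "((\<lambda>y. E y * (wave_rho0 x / QQ x y)) \<longlongrightarrow> E 1 * (wave_rho0 x / QQ x 1)) (at_left 1)"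
    using Q_wave_1_nz[OF assms] by (intro tendsto_intros limits_at_1) auto
  moreover have "rho_formula lam \<kappa> wave_u0 wave_rho0 x = (\<lambda>y. E y * (wave_rho0 x / QQ x y))"
    by (rule ext) (simp add: rho_formula_eq R_def)
  ultimately show ?thesis by auto
qed

text \<open>
  The local term is bounded here, so \<open>- nonlocal/P \<rightarrow> -\<infinity>\<close> dominates and is multiplied by the negative limit of \<open>E/\<lambda>\<close>.
\<close>

lemma ux_formula_at_top:
  assumes "lam \<le> - 1" "c x \<noteq> 1"
  shows "filterlim (ux_formula lam \<kappa> wave_u0 wave_rho0 x) at_top (at_left 1)"
proof -
  have "((\<lambda>y. 1 / P y) \<longlongrightarrow> 1 / P 1) (at_left 1)"
    using limits_at_1(2) by (intro tendsto_intros limits_at_1) auto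
  then have "filterlim (\<lambda>y. 1 / P y * nonlocal y) at_top (at_left 1)"
    by (rule filterlim_tendsto_pos_mult_at_top[OF _ _ nonlocal_diverges[OF assms(1)]])
       (use limits_at_1(2) in simp)
  moreover have "((\<lambda>y. - (num x y / QQ x y)) \<longlongrightarrow> - (num x 1 / QQ x 1)) (at_left 1)"
    using Q_wave_1_nz[OF assms(2)] by (intro tendsto_intros limits_at_1) auto
  ultimately have "filterlim (\<lambda>y. - (num x y / QQ x y) + 1 / P y * nonlocal y) at_top (at_left 1)"
    using filterlim_tendsto_add_at_top by blast
  moreover have "((\<lambda>y. - E y / lam) \<longlongrightarrow> - E 1 / lam) (at_left 1)"
    using lam by (intro tendsto_intros limits_at_1) auto
  moreover have "0 < - E 1 / lam" using lam limits_at_1(4) by (simp add: divide_pos_neg)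
  ultimately have "filterlim (\<lambda>y. - E y / lam * (- (num x y / QQ x y) + 1 / P y * nonlocal y)) at_top (at_left 1)"
    using filterlim_tendsto_pos_mult_at_top by blast
  moreover have "- E y / lam * (- (num x y / QQ x y) + 1 / P y * nonlocal y) = ux_formula lam \<kappa> wave_u0 wave_rho0 x y" for y
    by (simp add: ux_formula_wave algebra_simps)
  ultimately show ?thesis by simp
qed

lemma filterlim_along:
  assumes "filterlim f A (at_left 1)" "\<And>t. t \<in> {0..<ts} \<Longrightarrow> h t = f (\<eta> t)"
  shows "filterlim h A (at_left ts)"
proof -
  have lim: "filterlim (\<lambda>t. f (\<eta> t)) A (at_left ts)" by (rule filterlim_compose[OF assms(1) filterlim_eta])
  have ev: "\<forall>\<^sub>F t in at_left ts. h t = f (\<eta> t)"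
    unfolding eventually_at_left[OF ts_pos] using assms(2) ts_pos by (intro exI[of _ 0]) simp
  show ?thesis by (rule filterlim_cong[OF refl refl ev, THEN iffD2, OF lim])
qed

text \<open>
  \<open>\<eta>\<close> maps \<open>[0, ts)\<close> into \<open>[0, 1)\<close> and tends to 1, so limits and bounds in \<open>\<eta>\<close> carry over to the time variable.
\<close>

lemma remains_finite_along:
  assumes "continuous_on {0..<1} f" "\<exists>L. (f \<longlongrightarrow> L) (at_left 1)"
    and h: "\<And>t. t \<in> {0..<ts} \<Longrightarrow> h t = f (\<eta> t)"
  shows "remains_finite ts h"
proof -
  obtain L where L: "(f \<longlongrightarrow> L) (at_left 1)" using assms(2) ..
  have "h ` {0..<ts} \<subseteq> f ` {0..<1}" using h eta_range by force
  then have "bounded (h ` {0..<ts})"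
    by (rule bounded_subset[OF bounded_image_half_open[OF zero_less_one assms(1) L]])
  then show ?thesis unfolding remains_finite_def using filterlim_along[OF L h] by blast
qed

lemma wave_solution_exists: "\<exists>u \<rho> \<gamma>. represented_solution lam \<kappa> wave_u0 wave_rho0 \<eta> ts u \<rho> \<gamma>"
proof -
  interpret fl: odd_flow lam \<kappa> wave_u0 wave_rho0 "\<lambda>x. 2 * c x / (3 * lam)"
    "\<lambda>x. - 4 * pi * sin (2 * pi * x) / (3 * lam)" "\<lambda>_. 0" "-1" 1 ts \<eta>
    by unfold_locales (use is_eta_wave eta_range in \<open>force+\<close>)
  show ?thesis using fl.represented_solution by blast
qed

lemma wave_behaviour:
  assumes "represented_solution lam \<kappa> wave_u0 wave_rho0 \<eta> ts u \<rho> \<gamma>" and x: "x \<in> {0..1}"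
  shows "c x = 1 \<Longrightarrow> filterlim (\<lambda>t. D_x u (\<gamma> x t) t) at_bot (at_left ts)"
    and "c x = 1 \<Longrightarrow> filterlim (\<lambda>t. \<rho> (\<gamma> x t) t) at_top (at_left ts)"
    and "-1 < lam \<Longrightarrow> c x \<noteq> 1 \<Longrightarrow> remains_finite ts (\<lambda>t. D_x u (\<gamma> x t) t)"
    and "lam \<le> -1 \<Longrightarrow> c x \<noteq> 1 \<Longrightarrow> filterlim (\<lambda>t. D_x u (\<gamma> x t) t) at_top (at_left ts)"
    and "c x \<noteq> 1 \<Longrightarrow> remains_finite ts (\<lambda>t. \<rho> (\<gamma> x t) t)"
proof -
  have rep: "D_x u (\<gamma> x t) t = ux_formula lam \<kappa> wave_u0 wave_rho0 x (\<eta> t)"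
    "\<rho> (\<gamma> x t) t = rho_formula lam \<kappa> wave_u0 wave_rho0 x (\<eta> t)" if "t \<in> {0..<ts}" for t
    using assms that unfolding represented_solution_def by blast+
  have cont: "continuous_on {0..<1} (ux_formula lam \<kappa> wave_u0 wave_rho0 x)" "continuous_on {0..<1} (rho_formula lam \<kappa> wave_u0 wave_rho0 x)"
    by (rule continuous_on_formulas; force)+
  show "c x = 1 \<Longrightarrow> filterlim (\<lambda>t. D_x u (\<gamma> x t) t) at_bot (at_left ts)"
    by (rule filterlim_along[OF ux_formula_at_bot rep(1)])
  show "c x = 1 \<Longrightarrow> filterlim (\<lambda>t. \<rho> (\<gamma> x t) t) at_top (at_left ts)"
    by (rule filterlim_along[OF rho_formula_at_top rep(2)])
  show "-1 < lam \<Longrightarrow> c x \<noteq> 1 \<Longrightarrow> remains_finite ts (\<lambda>t. D_x u (\<gamma> x t) t)"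
    by (rule remains_finite_along[OF cont(1) ux_formula_converges rep(1)])
  show "lam \<le> -1 \<Longrightarrow> c x \<noteq> 1 \<Longrightarrow> filterlim (\<lambda>t. D_x u (\<gamma> x t) t) at_top (at_left ts)"
    by (rule filterlim_along[OF ux_formula_at_top rep(1)])
  show "c x \<noteq> 1 \<Longrightarrow> remains_finite ts (\<lambda>t. \<rho> (\<gamma> x t) t)"
    by (rule remains_finite_along[OF cont(2) rho_formula_converges rep(2)])
qed

end

section \<open>Blowup\<close>

theorem theorem4p49:
  fixes lam \<kappa> :: real
  assumes "lam < 0" and "\<kappa> < 0"
  shows "\<exists>u0 \<rho>0 \<eta>s ts \<eta>.
    admissible_data lam \<kappa> u0 \<rho>0 \<and>
    single_root_data lam \<kappa> u0 \<rho>0 \<eta>s \<and>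
    0 < ts \<and> is_t_star lam \<kappa> u0 \<rho>0 \<eta>s ts \<and>
    is_eta lam \<kappa> u0 \<rho>0 ts \<eta> \<and>
    (\<exists>u \<rho> \<gamma>. represented_solution lam \<kappa> u0 \<rho>0 \<eta> ts u \<rho> \<gamma>) \<and>
    (\<forall>u \<rho> \<gamma>. represented_solution lam \<kappa> u0 \<rho>0 \<eta> ts u \<rho> \<gamma> \<longrightarrow>
       (\<forall>\<alpha>\<in>alpha_bar lam \<kappa> u0 \<rho>0.
          filterlim (\<lambda>t. D_x u (\<gamma> \<alpha> t) t) at_bot (at_left ts)) \<and>
       (-1 < lam \<longrightarrow> (\<forall>\<alpha>\<in>{0..1} - alpha_bar lam \<kappa> u0 \<rho>0.
          remains_finite ts (\<lambda>t. D_x u (\<gamma> \<alpha> t) t))) \<and>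
       (lam \<le> -1 \<longrightarrow> (\<forall>\<alpha>\<in>{0..1} - alpha_bar lam \<kappa> u0 \<rho>0.
          filterlim (\<lambda>t. D_x u (\<gamma> \<alpha> t) t) at_top (at_left ts))) \<and>
       (\<forall>\<alpha>\<in>alpha_bar lam \<kappa> u0 \<rho>0.
          (\<rho>0 \<alpha> > 0 \<longrightarrow> filterlim (\<lambda>t. \<rho> (\<gamma> \<alpha> t) t) at_top (at_left ts)) \<and>
          (\<rho>0 \<alpha> < 0 \<longrightarrow> filterlim (\<lambda>t. \<rho> (\<gamma> \<alpha> t) t) at_bot (at_left ts))) \<and>
       (\<forall>\<alpha>\<in>{0..1} - alpha_bar lam \<kappa> u0 \<rho>0.
          remains_finite ts (\<lambda>t. \<rho> (\<gamma> \<alpha> t) t)))"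
proof -
  interpret wave lam \<kappa> using assms by unfold_locales
  have bar: "\<alpha> \<in> {0..1}" "c \<alpha> = 1" if "\<alpha> \<in> alpha_bar lam \<kappa> wave_u0 wave_rho0" for \<alpha>
    using that alpha_bar_iff[of \<alpha>] by (auto simp: alpha_bar_wave)
  have nbar: "\<alpha> \<in> {0..1}" "c \<alpha> \<noteq> 1" if "\<alpha> \<in> {0..1} - alpha_bar lam \<kappa> wave_u0 wave_rho0" for \<alpha>
    using that alpha_bar_iff by auto
  show ?thesis
  proof (rule exI[of _ wave_u0], rule exI[of _ wave_rho0], rule exI[of _ 1], rule exI[of _ ts], rule exI[of _ \<eta>],
      intro conjI allI impI ballI)
    show "admissible_data lam \<kappa> wave_u0 wave_rho0" "single_root_data lam \<kappa> wave_u0 wave_rho0 1" "0 < ts"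
      "is_t_star lam \<kappa> wave_u0 wave_rho0 1 ts" "is_eta lam \<kappa> wave_u0 wave_rho0 ts \<eta>"
      "\<exists>u \<rho> \<gamma>. represented_solution lam \<kappa> wave_u0 wave_rho0 \<eta> ts u \<rho> \<gamma>"
      by (rule admissible_wave single_root_wave ts_pos is_t_star_wave is_eta_wave wave_solution_exists)+
    fix u \<rho> \<gamma> \<alpha> assume rep: "represented_solution lam \<kappa> wave_u0 wave_rho0 \<eta> ts u \<rho> \<gamma>"
    {
      assume \<alpha>: "\<alpha> \<in> alpha_bar lam \<kappa> wave_u0 wave_rho0"
      note w = wave_behaviour[OF rep bar(1)[OF \<alpha>]]
      show "filterlim (\<lambda>t. D_x u (\<gamma> \<alpha> t) t) at_bot (at_left ts)" by (rule w(1)[OF bar(2)[OF \<alpha>]])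
      show "filterlim (\<lambda>t. \<rho> (\<gamma> \<alpha> t) t) at_top (at_left ts)" by (rule w(2)[OF bar(2)[OF \<alpha>]])
      show "filterlim (\<lambda>t. \<rho> (\<gamma> \<alpha> t) t) at_bot (at_left ts)" if "wave_rho0 \<alpha> < 0"
        using that wave_rho0_eq(3)[of \<alpha>] by simp
    next
      assume \<alpha>: "\<alpha> \<in> {0..1} - alpha_bar lam \<kappa> wave_u0 wave_rho0"
      note w = wave_behaviour[OF rep nbar(1)[OF \<alpha>]] and c = nbar(2)[OF \<alpha>]
      show "remains_finite ts (\<lambda>t. D_x u (\<gamma> \<alpha> t) t)" if "-1 < lam" by (rule w(3)[OF that c])
      show "filterlim (\<lambda>t. D_x u (\<gamma> \<alpha> t) t) at_top (at_left ts)" if "lam \<le> -1" by (rule w(4)[OF that c])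
      show "remains_finite ts (\<lambda>t. \<rho> (\<gamma> \<alpha> t) t)" by (rule w(5)[OF c])
    }
  qed
qed

end
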